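(* Let $H_1$ and $H_2$ be two holes in $G_0$. Then either $\tau(H_1)\cap\tau(H_2)=\emptyset$ or $\tau(H_1)=\tau(H_2)$. In the latter case, $H_1$ and $H_2$ share the same component in their first level (i.e. the level component containing the vertices of $H_1$ in its first level coincides with the level component containing the vertices of $H_2$ in its first level).
   Context: A hole is an induced cycle of length at least $4$; an even hole is a hole of even length. Let $G$ be a graph with no induced claw ($K_{1,3}$) and no even hole. Fix two adjacent vertices $u_0,u_1$ of $G$, let $B_0=N_G(u_0)\setminus\{u_1\}$, and let $G_0$ be the connected component of $G-B_0$ containing $u_0$. For $j\ge 0$, $L_j=\{u\in V(G_0): d_{G_0}(u,u_0)=j\}$. A level component in $L_j$ is a connected component of $G_0[L_j]$. For a hole $H$ of $G_0$, let $i_0=\min\{i: L_i\cap V(H)\ne\emptyset\}$ and $j_0=\max\{i: L_i\cap V(H)\ne\emptyset\}$; $L_{i_0}$ is its first level. A component of $H$ in $L_j$ is a level component in $L_j$ containing a vertex of $H$, and $\tau(H)$ is the set of all components of $H$ in $L_j$ for $i_0+1\le j\le j_0$ (components in the first level are excluded). *)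

theory Defs
  imports Main
begin

text \<open>
  An undirected graph is given by its vertex set and its adjacency relation; \<open>simple_graph\<close>
  requires the vertex set to be finite and the relation to be symmetric and irreflexive.
\<close>

record 'a sgraph =
  verts :: "'a set"
  edges :: "('a \<times> 'a) set"

definition simple_graph :: "'a sgraph \<Rightarrow> bool" where
  "simple_graph G \<longleftrightarrow>
     finite (verts G) \<and> edges G \<subseteq> verts G \<times> verts G \<and> sym (edges G) \<and> irrefl (edges G)"

definition neighbours :: "'a sgraph \<Rightarrow> 'a \<Rightarrow> 'a set" where
  "neighbours G v = {w \<in> verts G. (v, w) \<in> edges G}"

definition induced :: "'a sgraph \<Rightarrow> 'a set \<Rightarrow> 'a sgraph" where
  "induced G S = \<lparr>verts = verts G \<inter> S, edges = edges G \<inter> S \<times> S\<rparr>"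

definition delete :: "'a sgraph \<Rightarrow> 'a set \<Rightarrow> 'a sgraph" where
  "delete G S = induced G (verts G - S)"

definition component_of :: "'a sgraph \<Rightarrow> 'a \<Rightarrow> 'a set" where
  "component_of G v = {w \<in> verts G. (v, w) \<in> (edges G)\<^sup>*}"

text \<open>Connected components are represented by their vertex sets.\<close>

definition components :: "'a sgraph \<Rightarrow> 'a set set" where
  "components G = component_of G ` verts G"

text \<open>The distance is only meaningful for vertices in the same component.\<close>

definition distance :: "'a sgraph \<Rightarrow> 'a \<Rightarrow> 'a \<Rightarrow> nat" where
  "distance G u v = (LEAST n. (u, v) \<in> edges G ^^ n)"

definition cycle_graph :: "'a sgraph \<Rightarrow> bool" where
  "cycle_graph H \<longleftrightarrow>
     (\<exists>vs. length vs \<ge> 3 \<and> distinct vs \<and> verts H = set vs \<and>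
        edges H = {(vs ! i, vs ! j) | i j. i < length vs \<and> j < length vs \<and>
                     (j = Suc i mod length vs \<or> i = Suc j mod length vs)})"

definition hole :: "'a sgraph \<Rightarrow> 'a sgraph \<Rightarrow> bool" where
  "hole G H \<longleftrightarrow> H = induced G (verts H) \<and> cycle_graph H \<and> card (verts H) \<ge> 4"

definition even_hole :: "'a sgraph \<Rightarrow> 'a sgraph \<Rightarrow> bool" where
  "even_hole G H \<longleftrightarrow> hole G H \<and> even (card (verts H))"

definition claw :: "'a sgraph \<Rightarrow> bool" where
  "claw K \<longleftrightarrow>
     (\<exists>c x y z. distinct [c, x, y, z] \<and> verts K = {c, x, y, z} \<and>
        edges K = {c} \<times> {x, y, z} \<union> {x, y, z} \<times> {c})"

definition claw_free :: "'a sgraph \<Rightarrow> bool" where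
  "claw_free G \<longleftrightarrow> \<not> (\<exists>S \<subseteq> verts G. claw (induced G S))"

definition even_hole_free :: "'a sgraph \<Rightarrow> bool" where
  "even_hole_free G \<longleftrightarrow> \<not> (\<exists>H. even_hole G H)"

text \<open>In the following, \<open>A\<close> is a connected graph with root \<open>r\<close>.\<close>

definition level :: "'a sgraph \<Rightarrow> 'a \<Rightarrow> nat \<Rightarrow> 'a set" where
  "level A r j = {u \<in> verts A. distance A u r = j}"

definition level_components :: "'a sgraph \<Rightarrow> 'a \<Rightarrow> nat \<Rightarrow> 'a set set" where
  "level_components A r j = components (induced A (level A r j))"

definition first_index :: "'a sgraph \<Rightarrow> 'a \<Rightarrow> 'a sgraph \<Rightarrow> nat" where
  "first_index A r H = Min {i. level A r i \<inter> verts H \<noteq> {}}"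

definition last_index :: "'a sgraph \<Rightarrow> 'a \<Rightarrow> 'a sgraph \<Rightarrow> nat" where
  "last_index A r H = Max {i. level A r i \<inter> verts H \<noteq> {}}"

definition hole_components :: "'a sgraph \<Rightarrow> 'a \<Rightarrow> 'a sgraph \<Rightarrow> nat \<Rightarrow> 'a set set" where
  "hole_components A r H j = {C \<in> level_components A r j. C \<inter> verts H \<noteq> {}}"

definition tau :: "'a sgraph \<Rightarrow> 'a \<Rightarrow> 'a sgraph \<Rightarrow> 'a set set" where
  "tau A r H = (\<Union>j \<in> {first_index A r H + 1 .. last_index A r H}. hole_components A r H j)"

text \<open>
  A predicate rather than a function: it contains the claim that all vertices of \<open>H\<close> in its
  first level lie in one level component. As there is at least one such vertex,
  at most one \<open>C\<close> satisfies it.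
\<close>

definition is_first_component :: "'a sgraph \<Rightarrow> 'a \<Rightarrow> 'a sgraph \<Rightarrow> 'a set \<Rightarrow> bool" where
  "is_first_component A r H C \<longleftrightarrow>
     C \<in> level_components A r (first_index A r H) \<and>
     verts H \<inter> level A r (first_index A r H) \<subseteq> C"

end

theory Submission imports Defs begin

text \<open>Distances from \<open>u\<^sub>0\<close> arrange \<open>G\<^sub>0\<close> in levels, and the children of a vertex form a clique, because the
  vertex also has a parent and there is no claw. Hence an induced path with both ends in one level
  and no vertex above that level can be closed by going up from both ends until the ancestors are
  adjacent. This adds an even number of vertices, so the path has an odd number of vertices.

  This parity principle implies that adjacent vertices of a level have nested sets of parents, that
  level components have dominating vertices, and that every hole consists of two vertical paths
  from a bottom vertex up to two adjacent vertices. The parents of an intermediate component of a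
  hole form a clique, so the component of the bottom vertex determines all components of the hole.
  If two holes shared a component but not their bottom components, their lower parts could be
  joined to an even path or to an even hole, contrary to the parity principle.\<close>

section \<open>Induced paths and cycles as vertex lists\<close>

text \<open>The deletion of \<open>B\<^sub>0\<close> leaves at most one vertex in each of the levels
  0 and 1. Two distinct nonadjacent ancestors therefore never run into the root, which is why the
  closing procedure must stop at an adjacent pair. It can only be started if each end of the path
  has a parent that no other vertex of the path sees; most case distinctions serve to establish
  this.

  The delicate place of a hole is the level just above its bottom vertex. There both sides are
  adjacent to the bottom vertex, so the claw that keeps the sides in different components further up
  is missing, and the parents of the bottom component are only known to lie in the union of two
  components. Hence the sides of two holes with a common bottom component can be matched only up to
  a swap.

  A further obstacle is that two holes may part on different levels on their two sides. Cutting both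
  holes at the same pair of levels keeps the total number of vertices even, whatever the depths of
  the two bottoms are.\<close>

definition induced_path :: "'a sgraph \<Rightarrow> 'a list \<Rightarrow> bool" where
  "induced_path A xs \<longleftrightarrow> distinct xs \<and> set xs \<subseteq> verts A \<and>
     (\<forall>i < length xs. \<forall>j < length xs. (xs ! i, xs ! j) \<in> edges A \<longleftrightarrow> j = Suc i \<or> i = Suc j)"

text \<open>Triangles satisfy this as well, so every appeal to parity carries a separate length
  bound of 4. The list fixes a starting vertex and a direction; rotation and reversal make both
  arbitrary.\<close>

definition induced_cycle :: "'a sgraph \<Rightarrow> 'a list \<Rightarrow> bool" where
  "induced_cycle A xs \<longleftrightarrow> distinct xs \<and> set xs \<subseteq> verts A \<and>
     (\<forall>i < length xs. \<forall>j < length xs. (xs ! i, xs ! j) \<in> edges A \<longleftrightarrow>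
        j = Suc i mod length xs \<or> i = Suc j mod length xs)"

lemma induced_path_singleton:
  assumes "irrefl (edges A)" "x \<in> verts A"
  shows "induced_path A [x]"
  using assms by (auto simp: induced_path_def irrefl_def)

lemma induced_path_append:
  assumes sym: "sym (edges A)" and xs: "induced_path A xs" and ys: "induced_path A ys"
    and ne: "xs \<noteq> []" "ys \<noteq> []"
    and cross: "\<And>x y. x \<in> set xs \<Longrightarrow> y \<in> set ys \<Longrightarrow>
      x \<noteq> y \<and> ((x, y) \<in> edges A \<longleftrightarrow> x = last xs \<and> y = hd ys)"
  shows "induced_path A (xs @ ys)"
proof -
  let ?n = "length xs"
  have sym_conv: "(v, u) \<in> edges A \<longleftrightarrow> (u, v) \<in> edges A" if "u \<in> set xs" "v \<in> set ys" for u v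
    using sym by (auto dest: symD)
  have dx: "distinct xs" and dy: "distinct ys" using xs ys by (auto simp: induced_path_def)
  have mixed: "(xs ! i, ys ! j) \<in> edges A \<longleftrightarrow> ?n + j = Suc i"
    if "i < ?n" "j < length ys" for i j
  proof -
    have "xs ! i = last xs \<longleftrightarrow> i = ?n - 1"
      using that ne dx by (simp add: last_conv_nth nth_eq_iff_index_eq)
    moreover have "ys ! j = hd ys \<longleftrightarrow> j = 0"
      using that ne dy by (simp add: hd_conv_nth nth_eq_iff_index_eq)
    ultimately show ?thesis using cross[of "xs ! i" "ys ! j"] that by auto
  qed
  have "((xs @ ys) ! i, (xs @ ys) ! j) \<in> edges A \<longleftrightarrow> j = Suc i \<or> i = Suc j"
    if ij: "i < length (xs @ ys)" "j < length (xs @ ys)" for i j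
  proof -
    consider "i < ?n" "j < ?n" | "i < ?n" "j \<ge> ?n" | "i \<ge> ?n" "j < ?n" | "i \<ge> ?n" "j \<ge> ?n"
      by linarith
    then show ?thesis
    proof cases
      case 1 then show ?thesis using xs by (auto simp: nth_append induced_path_def)
    next
      case 2 then show ?thesis using mixed[of i "j - ?n"] ij by (auto simp: nth_append)
    next
      case 3
      then show ?thesis using mixed[of j "i - ?n"] ij by (auto simp: nth_append sym_conv)
    next
      case 4
      then have "(ys ! (i - ?n), ys ! (j - ?n)) \<in> edges A \<longleftrightarrow>
          j - ?n = Suc (i - ?n) \<or> i - ?n = Suc (j - ?n)"
        using ys ij by (simp add: induced_path_def)
      moreover have "(xs @ ys) ! i = ys ! (i - ?n)" "(xs @ ys) ! j = ys ! (j - ?n)"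
        using 4 by (simp_all add: nth_append)
      ultimately show ?thesis using 4 by simp arith
    qed
  qed
  moreover have "distinct (xs @ ys)" using dx dy cross by auto
  moreover have "set (xs @ ys) \<subseteq> verts A" using xs ys by (simp add: induced_path_def)
  ultimately show ?thesis unfolding induced_path_def by blast
qed

lemma induced_path_rev:
  assumes "induced_path A xs"
  shows "induced_path A (rev xs)"
proof -
  have "(rev xs ! i, rev xs ! j) \<in> edges A \<longleftrightarrow> j = Suc i \<or> i = Suc j"
    if "i < length xs" "j < length xs" for i j
  proof -
    have "(xs ! (length xs - Suc i), xs ! (length xs - Suc j)) \<in> edges A \<longleftrightarrow>
        length xs - Suc j = Suc (length xs - Suc i) \<or> length xs - Suc i = Suc (length xs - Suc j)"
      using assms that by (simp add: induced_path_def)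
    then show ?thesis using that by (simp add: rev_nth) arith
  qed
  then show ?thesis using assms by (simp add: induced_path_def)
qed

lemma induced_cycle_append:
  assumes sym: "sym (edges A)" and xs: "induced_path A xs" and ys: "induced_path A ys"
    and ne: "xs \<noteq> []" "ys \<noteq> []" and len: "length xs + length ys \<ge> 3"
    and cross: "\<And>x y. x \<in> set xs \<Longrightarrow> y \<in> set ys \<Longrightarrow>
      x \<noteq> y \<and> ((x, y) \<in> edges A \<longleftrightarrow> x = last xs \<and> y = hd ys \<or> x = hd xs \<and> y = last ys)"
  shows "induced_cycle A (xs @ ys)"
proof -
  let ?n = "length xs" and ?m = "length ys"
  have sym_conv: "(v, u) \<in> edges A \<longleftrightarrow> (u, v) \<in> edges A" if "u \<in> set xs" "v \<in> set ys" for u v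
    using sym by (auto dest: symD)
  have dx: "distinct xs" and dy: "distinct ys" using xs ys by (auto simp: induced_path_def)
  have mixed: "(xs ! i, ys ! j) \<in> edges A \<longleftrightarrow> ?n + j = Suc i \<or> i = 0 \<and> Suc j = ?m"
    if "i < ?n" "j < ?m" for i j
  proof -
    have "xs ! i = last xs \<longleftrightarrow> i = ?n - 1" "ys ! j = last ys \<longleftrightarrow> j = ?m - 1"
      using that ne dx dy by (simp_all add: last_conv_nth nth_eq_iff_index_eq)
    moreover have "xs ! i = hd xs \<longleftrightarrow> i = 0" "ys ! j = hd ys \<longleftrightarrow> j = 0"
      using that ne dx dy by (simp_all add: hd_conv_nth nth_eq_iff_index_eq)
    ultimately have "(xs ! i, ys ! j) \<in> edges A \<longleftrightarrow> i = ?n - 1 \<and> j = 0 \<or> i = 0 \<and> j = ?m - 1"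
      using cross[of "xs ! i" "ys ! j"] that by (metis nth_mem)
    then show ?thesis using that by arith
  qed
  have Smod: "Suc i mod (?n + ?m) = (if Suc i = ?n + ?m then 0 else Suc i)"
    if "i < ?n + ?m" for i using that by auto
  have "((xs @ ys) ! i, (xs @ ys) ! j) \<in> edges A \<longleftrightarrow>
      j = Suc i mod (?n + ?m) \<or> i = Suc j mod (?n + ?m)"
    if ij: "i < ?n + ?m" "j < ?n + ?m" for i j
  proof -
    consider "i < ?n" "j < ?n" | "i < ?n" "j \<ge> ?n" | "i \<ge> ?n" "j < ?n" | "i \<ge> ?n" "j \<ge> ?n"
      by linarith
    then show ?thesis
    proof cases
      case 1
      then have "(xs ! i, xs ! j) \<in> edges A \<longleftrightarrow> j = Suc i \<or> i = Suc j"
        using xs by (simp add: induced_path_def)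
      moreover have "Suc i \<noteq> ?n + ?m" "Suc j \<noteq> ?n + ?m" using 1 ne by (cases ys; simp)+
      ultimately show ?thesis using 1 by (simp add: nth_append Smod)
    next
      case 2
      then show ?thesis using mixed[of i "j - ?n"] ij len by (auto simp: nth_append Smod)
    next
      case 3
      then show ?thesis using mixed[of j "i - ?n"] ij len
        by (auto simp: nth_append Smod sym_conv)
    next
      case 4
      then have "(ys ! (i - ?n), ys ! (j - ?n)) \<in> edges A \<longleftrightarrow>
          j - ?n = Suc (i - ?n) \<or> i - ?n = Suc (j - ?n)"
        using ys ij by (simp add: induced_path_def)
      moreover have "(xs @ ys) ! i = ys ! (i - ?n)" "(xs @ ys) ! j = ys ! (j - ?n)"
        using 4 by (simp_all add: nth_append)
      moreover have "0 < i" "0 < j" using 4 ne by (cases xs; auto)+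
      ultimately show ?thesis using 4 ij by (simp add: Smod) arith
    qed
  qed
  moreover have "distinct (xs @ ys)" using dx dy cross by auto
  moreover have "set (xs @ ys) \<subseteq> verts A" using xs ys by (simp add: induced_path_def)
  ultimately show ?thesis unfolding induced_cycle_def length_append by blast
qed

lemma induced_cycle_rotate1:
  assumes "induced_cycle A xs"
  shows "induced_cycle A (rotate1 xs)"
proof -
  let ?n = "length xs"
  have shift: "Suc j mod ?n = Suc (Suc i mod ?n) mod ?n \<longleftrightarrow> j = Suc i mod ?n"
    if "i < ?n" "j < ?n" for i j
    using that by (auto simp: mod_Suc)
  have "(rotate1 xs ! i, rotate1 xs ! j) \<in> edges A \<longleftrightarrow>
      j = Suc i mod ?n \<or> i = Suc j mod ?n" if ij: "i < ?n" "j < ?n" for i j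
  proof -
    have "?n > 0" using ij by linarith
    then have "(xs ! (Suc i mod ?n), xs ! (Suc j mod ?n)) \<in> edges A \<longleftrightarrow>
        Suc j mod ?n = Suc (Suc i mod ?n) mod ?n \<or> Suc i mod ?n = Suc (Suc j mod ?n) mod ?n"
      using assms by (simp add: induced_cycle_def)
    then show ?thesis using ij shift by (simp add: nth_rotate1)
  qed
  then show ?thesis using assms by (simp add: induced_cycle_def)
qed

lemma induced_cycle_rotate: "induced_cycle A xs \<Longrightarrow> induced_cycle A (rotate k xs)"
  by (induction k) (simp_all add: induced_cycle_rotate1)

lemma induced_cycle_rev:
  assumes "induced_cycle A xs"
  shows "induced_cycle A (rev xs)"
proof -
  let ?n = "length xs"
  have refl: "?n - Suc j = Suc (?n - Suc i) mod ?n \<longleftrightarrow> i = Suc j mod ?n"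
    if "i < ?n" "j < ?n" for i j
  proof (cases "i = 0")
    case True
    then show ?thesis using that by (cases "Suc j = ?n") auto
  next
    case False
    then have "Suc (?n - Suc i) < ?n" using that by auto
    then show ?thesis using that False by (cases "Suc j = ?n") auto
  qed
  have "(rev xs ! i, rev xs ! j) \<in> edges A \<longleftrightarrow> j = Suc i mod ?n \<or> i = Suc j mod ?n"
    if ij: "i < ?n" "j < ?n" for i j
  proof -
    have "(xs ! (?n - Suc i), xs ! (?n - Suc j)) \<in> edges A \<longleftrightarrow>
        ?n - Suc j = Suc (?n - Suc i) mod ?n \<or> ?n - Suc i = Suc (?n - Suc j) mod ?n"
      using assms ij by (simp add: induced_cycle_def)
    then show ?thesis using ij refl by (auto simp: rev_nth)
  qed
  then show ?thesis using assms by (simp add: induced_cycle_def)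
qed

section \<open>Arcs of an induced cycle\<close>

lemma induced_cycle_take:
  assumes "induced_cycle A vs" "k < length vs"
  shows "induced_path A (take k vs)"
proof -
  have "(vs ! i, vs ! j) \<in> edges A \<longleftrightarrow> j = Suc i \<or> i = Suc j" if "i < k" "j < k" for i j
    using assms that by (simp add: induced_cycle_def)
  moreover have "distinct (take k vs)" "set (take k vs) \<subseteq> verts A"
    using assms(1) set_take_subset[of k vs] by (auto simp: induced_cycle_def)
  ultimately show ?thesis using assms(2) by (simp add: induced_path_def)
qed

text \<open>An arc that runs across the closing edge of the list is a prefix of the list rotated by
  \<open>m\<close>, and a proper one because of \<open>k < m\<close>.\<close>

lemma induced_cycle_arc:
  assumes C: "induced_cycle A vs" and "k < m" "m \<le> length vs"
  shows "induced_path A (drop m vs @ take k vs)"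
proof (cases "m = length vs")
  case True
  then show ?thesis using induced_cycle_take[OF C] assms by simp
next
  case False
  then have "drop m vs @ take k vs = take (length vs - m + k) (rotate m vs)"
    using assms by (simp add: rotate_drop_take)
  then show ?thesis
    using induced_cycle_take[OF induced_cycle_rotate[OF C], of "length vs - m + k" m] assms by simp
qed

lemma induced_cycle_adj:
  assumes "induced_cycle A vs" "i < length vs" "j < length vs"
  shows "(vs ! i, vs ! j) \<in> edges A \<longleftrightarrow>
    j = Suc i \<or> i = Suc j \<or> i = 0 \<and> Suc j = length vs \<or> j = 0 \<and> Suc i = length vs"
proof -
  have "(vs ! i, vs ! j) \<in> edges A \<longleftrightarrow> j = Suc i mod length vs \<or> i = Suc j mod length vs"
    using assms by (simp add: induced_cycle_def)
  then show ?thesis using assms(2,3) by (auto simp: mod_Suc)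
qed

text \<open>After a descent the sequence cannot turn upward again, since this would create a local
  minimum. It therefore rises up to the first descent and falls from there on. This is what makes
  the two sides of a hole equally long.\<close>

lemma unimodal:
  fixes f :: "nat \<Rightarrow> nat"
  assumes ends: "f 0 = a" "f N = a" "0 < N"
    and step: "\<And>i. i < N \<Longrightarrow> f (Suc i) = Suc (f i) \<or> f i = Suc (f (Suc i))"
    and no_min: "\<And>i. Suc i < N \<Longrightarrow> \<not> (f i = Suc (f (Suc i)) \<and> f (Suc (Suc i)) = Suc (f (Suc i)))"
  obtains k where "N = 2 * k" "\<And>i. i \<le> k \<Longrightarrow> f i = a + i" "\<And>i. i \<le> k \<Longrightarrow> f (N - i) = a + i"
proof -
  have rise: "f i = a + i" if "i \<le> m" "m \<le> N" "\<forall>i < m. f (Suc i) = Suc (f i)" for i m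
    using that by (induction i) (use ends in auto)
  define k where "k = (LEAST i. i < N \<and> f i = Suc (f (Suc i)))"
  have "\<exists>i. i < N \<and> f i = Suc (f (Suc i))"
    using rise[of N N] step ends by force
  then have k: "k < N" "f k = Suc (f (Suc k))" unfolding k_def
    by (metis (mono_tags, lifting) LeastI_ex)+
  have "f (Suc i) = Suc (f i)" if "i < k" for i
    using not_less_Least[of i "\<lambda>i. i < N \<and> f i = Suc (f (Suc i))"] step[of i] that k unfolding k_def
      by auto
  then have up: "f i = a + i" if "i \<le> k" for i using rise[of i k] that k by auto
  \<comment> \<open>On the falling part \<open>f i + i\<close> is constant. At \<open>i = N\<close>
    this invariant gives \<open>N = 2 * k\<close>, at the other indices the values counted from the
    end.\<close>
  have down: "f i + i = a + 2 * k \<and> (i < N \<longrightarrow> f i = Suc (f (Suc i)))" if "k \<le> i" "i \<le> N" for i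
    using that
  proof (induction i rule: dec_induct)
    case base
    then show ?case using up[of k] k by simp
  next
    case (step n)
    then have "f n + n = a + 2 * k" "f n = Suc (f (Suc n))" by auto
    then show ?case using no_min[of n] assms(4)[of "Suc n"] by auto
  qed
  have N: "N = 2 * k" using down[of N] ends k by auto
  have "f (N - i) = a + i" if "i \<le> k" for i
  proof -
    have "f (N - i) + (N - i) = a + 2 * k" using down[of "N - i"] that N by auto
    then show ?thesis using that N by linarith
  qed
  then show thesis using that N up by blast
qed

section \<open>Levelled graphs\<close>

text \<open>The level is an abstract function with the few properties of the distance to the root
  that the argument uses. The bound in \<open>lv_step\<close> is one-sided because symmetry of the
  edges supplies the other direction. The assumption \<open>lv_le_1\<close> is the trace of the edge
  between \<open>u\<^sub>0\<close> and \<open>u\<^sub>1\<close> and of the deletion of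
  \<open>B\<^sub>0\<close>.\<close>

locale levelled_graph =
  fixes A :: "'a sgraph" and lv :: "'a \<Rightarrow> nat"
  assumes simple: "simple_graph A"
    and claw_free: "claw_free A"
    and odd_cycle: "\<And>xs. induced_cycle A xs \<Longrightarrow> length xs \<ge> 4 \<Longrightarrow> odd (length xs)"
    and lv_step: "\<And>x y. (x, y) \<in> edges A \<Longrightarrow> lv y \<le> Suc (lv x)"
    and ex_parent: "\<And>x k. x \<in> verts A \<Longrightarrow> lv x = Suc k \<Longrightarrow> \<exists>p. (p, x) \<in> edges A \<and> lv p = k"
    and lv_le_1: "\<And>x y. x \<in> verts A \<Longrightarrow> y \<in> verts A \<Longrightarrow> lv x = lv y \<Longrightarrow> lv x \<le> 1 \<Longrightarrow> x = y"
begin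

abbreviation adj :: "'a \<Rightarrow> 'a \<Rightarrow> bool" (infix "\<sim>" 50) where
  "x \<sim> y \<equiv> (x, y) \<in> edges A"

lemma fin: "finite (verts A)" and sym_edges: "sym (edges A)" and irr: "irrefl (edges A)"
  using simple by (auto simp: simple_graph_def)

lemma adj_sym: "x \<sim> y \<Longrightarrow> y \<sim> x"
  using sym_edges by (rule symD)

lemma adj_irrefl: "\<not> x \<sim> x"
  using irr by (auto simp: irrefl_def)

lemma adj_verts: "x \<sim> y \<Longrightarrow> x \<in> verts A \<and> y \<in> verts A"
  using simple by (auto simp: simple_graph_def)

lemma no_claw:
  assumes "c \<sim> x" "c \<sim> y" "c \<sim> z" "x \<noteq> y" "y \<noteq> z" "x \<noteq> z"
  shows "x \<sim> y \<or> y \<sim> z \<or> x \<sim> z"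
proof (rule ccontr)
  assume non: "\<not> ?thesis"
  let ?S = "{c, x, y, z}"
  have S: "?S \<subseteq> verts A" using assms adj_verts by blast
  have "distinct [c, x, y, z]" using assms adj_irrefl by auto
  moreover have "verts (induced A ?S) = ?S" using S by (auto simp: induced_def)
  moreover have "edges (induced A ?S) = {c} \<times> {x, y, z} \<union> {x, y, z} \<times> {c}"
    using assms(1-3) non adj_irrefl adj_sym by (auto simp: induced_def)
  ultimately have "claw (induced A ?S)" unfolding claw_def by blast
  then show False using claw_free S unfolding claw_free_def by blast
qed

definition par :: "'a \<Rightarrow> 'a set" where
  "par x = {p. p \<sim> x \<and> lv x = Suc (lv p)}"

lemma parI: "p \<sim> x \<Longrightarrow> lv x = Suc (lv p) \<Longrightarrow> p \<in> par x"
  by (simp add: par_def)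

lemma parD: "p \<in> par x \<Longrightarrow> p \<sim> x" "p \<in> par x \<Longrightarrow> lv x = Suc (lv p)"
  by (simp_all add: par_def)

lemma par_ne: "x \<in> verts A \<Longrightarrow> lv x > 0 \<Longrightarrow> par x \<noteq> {}"
  using ex_parent[of x "lv x - 1"] by (auto simp: par_def)

lemma finite_par: "finite (par x)"
  using fin by (rule finite_subset[rotated]) (auto simp: par_def dest: adj_verts)

lemma siblings:
  assumes "p \<in> par x" "p \<in> par y"
  shows "x = y \<or> x \<sim> y"
proof (cases "lv p")
  \<comment> \<open>The root has no parent to complete a claw, but here \<open>x\<close> and
    \<open>y\<close> both lie in level 1, which has at most one vertex.\<close>
  case 0
  then show ?thesis using assms lv_le_1[of x y] adj_verts by (auto simp: par_def)
next
  case (Suc k)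
  then obtain q where q: "q \<sim> p" "lv q = k" using ex_parent[of p k] assms adj_verts
    by (auto simp: par_def)
  have lvs: "lv x = Suc (Suc k)" "lv y = Suc (Suc k)" using assms Suc by (auto simp: par_def)
  have "\<not> q \<sim> x" "\<not> q \<sim> y" using q lvs lv_step by fastforce+
  moreover have "q \<noteq> x" "q \<noteq> y" using q lvs by auto
  ultimately show ?thesis using no_claw[of p q x y] assms q adj_sym by (auto simp: par_def)
qed

text \<open>Two children of a vertex are adjacent, so the ancestors of the two ends stay distinct as
  long as they are nonadjacent. The first adjacent pair closes an induced cycle with an even
  number of additional vertices.\<close>

lemma cap:
  assumes "induced_path A xs" "length xs \<ge> 2" "\<forall>x \<in> set xs. k \<le> lv x"
    and "lv (hd xs) = k" "lv (last xs) = k"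
    and "p \<in> par (hd xs)" "\<forall>x \<in> set xs. p \<sim> x \<longrightarrow> x = hd xs"
    and "q \<in> par (last xs)" "\<forall>x \<in> set xs. q \<sim> x \<longrightarrow> x = last xs"
  shows "odd (length xs)"
  using assms
proof (induction k arbitrary: xs p q)
  case 0
  then show ?case by (simp add: par_def)
next
  case (Suc k)
  have ne: "xs \<noteq> []" using Suc.prems(2) by auto
  have lvp: "lv p = k" "lv q = k" using Suc.prems by (auto simp: par_def)
  have out: "p \<notin> set xs" "q \<notin> set xs" using lvp Suc.prems(3) by fastforce+
  have pq: "p \<noteq> q"
  proof
    assume "p = q"
    then have "hd xs = last xs" using Suc.prems ne by (metis last_in_set parD(1))
    moreover have "distinct xs" using Suc.prems(1) by (simp add: induced_path_def)
    ultimately show False using Suc.prems(2) ne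
      by (auto simp: hd_conv_nth last_conv_nth nth_eq_iff_index_eq)
  qed
  have pv: "p \<in> verts A" "q \<in> verts A" using Suc.prems adj_verts by (auto simp: par_def)
  have single: "induced_path A [p]" "induced_path A [q]"
    using induced_path_singleton[OF irr] pv by auto
  \<comment> \<open>Distinct vertices of one level cannot lie in level 0, so both have parents and
    the ascent can continue.\<close>
  have k0: "k > 0" using lv_le_1[of p q] lvp pv pq by (cases k) auto
  have ph: "p \<sim> hd xs" "q \<sim> last xs" using Suc.prems by (auto simp: par_def)
  show ?case
  proof (cases "p \<sim> q")
    case True
    have "induced_path A [q, p]"
      using induced_path_append[OF sym_edges single(2,1)] pq True adj_sym by auto
    then have "induced_cycle A ([q, p] @ xs)"
      by (rule induced_cycle_append[OF sym_edges _ Suc.prems(1)])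
        (use ne out ph Suc.prems(2,7,9) pq in \<open>auto\<close>)
    from odd_cycle[OF this] show ?thesis using Suc.prems(2) by simp
  next
    case False
    have "induced_path A ([p] @ xs)"
      by (rule induced_path_append[OF sym_edges single(1) Suc.prems(1)])
        (use ne out ph Suc.prems(7) in auto)
    then have path: "induced_path A (([p] @ xs) @ [q])"
      by (rule induced_path_append[OF sym_edges _ single(2)])
        (use ne out ph pq Suc.prems(9) False adj_sym in auto)
    obtain p' q' where par': "p' \<in> par p" "q' \<in> par q"
      using par_ne pv lvp k0 by (metis all_not_in_conv)
    have far: "\<not> p' \<sim> x" "\<not> q' \<sim> x" if "x \<in> set xs" for x
      using lv_step[of p' x] lv_step[of q' x] Suc.prems(3) that par' lvp
        by (fastforce simp: par_def)+
    have "\<not> p' \<sim> q" "\<not> q' \<sim> p"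
      using siblings[of p' p q] siblings[of q' p q] par' lvp False pq adj_sym
        by (auto simp: par_def)
    then have "odd (length (([p] @ xs) @ [q]))"
      using Suc.prems(2,3) lvp par' far
      by (intro Suc.IH[OF path, of p' q']) (auto intro: Suc_leD)
    then show ?thesis by simp
  qed
qed

text \<open>If each of \<open>x\<close> and \<open>y\<close> had a parent that the other lacks,
  \<open>cap\<close> would apply to the path consisting of these two vertices, an even
  number.\<close>

lemma par_comparable:
  assumes "x \<sim> y" "lv x = lv y"
  shows "par x \<subseteq> par y \<or> par y \<subseteq> par x"
proof (rule ccontr)
  assume "\<not> ?thesis"
  then obtain p q where pq: "p \<in> par x" "p \<notin> par y" "q \<in> par y" "q \<notin> par x" by auto
  have "induced_path A ([x] @ [y])"
    using assms adj_verts adj_irrefl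
    by (intro induced_path_append[OF sym_edges]) (auto intro: induced_path_singleton[OF irr])
  from cap[OF this, of "lv x" p q] show False using pq assms(2) by (auto simp: par_def)
qed

lemma ex_common_parent:
  assumes "x \<sim> y" "lv x = lv y"
  shows "\<exists>p. p \<in> par x \<and> p \<in> par y"
proof -
  have v: "x \<in> verts A" "y \<in> verts A" using adj_verts assms by auto
  have "lv x > 0" using lv_le_1[OF v assms(2)] assms(1) adj_irrefl by (cases "lv x") auto
  then show ?thesis using par_comparable[OF assms] par_ne[of x] par_ne[of y] v assms(2) by auto
qed

section \<open>Level components\<close>

text \<open>Level components are treated as classes of an equivalence relation. It relates every
  element of the type to itself, so membership in the vertex set is tracked separately, by
  \<open>conn_verts\<close>.\<close>

definition conn :: "'a \<Rightarrow> 'a \<Rightarrow> bool" where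
  "conn x y \<longleftrightarrow> (x, y) \<in> {(u, v). u \<sim> v \<and> lv u = lv v}\<^sup>*"

lemma conn_refl [simp]: "conn x x"
  by (simp add: conn_def)

lemma conn_adj: "x \<sim> y \<Longrightarrow> lv x = lv y \<Longrightarrow> conn x y"
  by (auto simp: conn_def)

lemma conn_sym: "conn x y \<Longrightarrow> conn y x"
  unfolding conn_def
  by (rule symD[OF sym_rtrancl]) (auto intro!: symI adj_sym)

lemma conn_trans: "conn x y \<Longrightarrow> conn y z \<Longrightarrow> conn x z"
  by (simp add: conn_def)

lemma conn_lv: "conn x y \<Longrightarrow> lv x = lv y"
  unfolding conn_def by (induction rule: rtrancl_induct) auto

lemma conn_verts: "conn x y \<Longrightarrow> x \<in> verts A \<Longrightarrow> y \<in> verts A"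
  unfolding conn_def by (induction rule: rtrancl_induct) (auto dest: adj_verts)

lemma siblings_conn: "p \<in> par x \<Longrightarrow> p \<in> par y \<Longrightarrow> conn x y"
  using siblings[of p x y] by (auto simp: par_def intro: conn_adj)

text \<open>The ends are not adjacent, so they have no common parent. The middle vertex has a common
  parent with each end; comparability then leaves only the inclusions of both outer sets in the
  middle one.\<close>

lemma par_path3:
  assumes "x \<sim> y" "y \<sim> z" "\<not> x \<sim> z" "x \<noteq> z" "lv x = lv y" "lv y = lv z"
  shows "par x \<subseteq> par y" "par z \<subseteq> par y" "par x \<inter> par z = {}"
proof -
  show disj: "par x \<inter> par z = {}" using siblings[of _ x z] assms by auto
  show "par x \<subseteq> par y" "par z \<subseteq> par y"
    using par_comparable[of x y] par_comparable[of y z] ex_common_parent[of x y]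
      ex_common_parent[of y z] disj assms by blast+
qed

text \<open>A shortest connection \<open>x\<close>, \<open>z\<close>, \<open>y\<close>,
  \<open>w\<close> inside a level is impossible: by \<open>par_path3\<close> the parents of
  \<open>x\<close> are parents of \<open>z\<close>, those of \<open>z\<close> are parents of
  \<open>y\<close>, and yet \<open>x\<close> and \<open>y\<close> have no common parent.\<close>

lemma conn_le_2:
  assumes "conn x y"
  shows "x = y \<or> x \<sim> y \<or> (\<exists>z. x \<sim> z \<and> z \<sim> y \<and> lv z = lv x)"
  using assms unfolding conn_def
proof (induction rule: rtrancl_induct)
  case (step y w)
  then have lvs: "lv x = lv y" "lv y = lv w" "y \<sim> w" using conn_lv[of x y] by (auto simp: conn_def)
  show ?case
  proof (rule ccontr)
    assume far: "\<not> ?thesis"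
    then obtain z where z: "x \<sim> z" "z \<sim> y" "lv z = lv x" "x \<noteq> y" "\<not> x \<sim> y"
      using step.IH lvs by metis
    then have zw: "\<not> z \<sim> w" "z \<noteq> w" using far by auto
    have "par x \<inter> par y = {}" "par x \<subseteq> par z" using par_path3[of x z y] z lvs by auto
    moreover have "par z \<subseteq> par y" using par_path3[of z y w] z zw lvs by auto
    ultimately show False using ex_common_parent[of x z] z by auto
  qed
qed simp

text \<open>Any vertex \<open>d\<close> with the largest number of parents works. Neighbours of
  \<open>d\<close> in its level are settled by comparability. For a vertex \<open>w\<close> at
  distance two with middle vertex \<open>z\<close>, the parents of \<open>d\<close> and of
  \<open>w\<close> are disjoint subsets of those of \<open>z\<close>; maximality gives
  \<open>par z = par d\<close>, and nothing is left for \<open>w\<close>.\<close>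

lemma dominating:
  assumes v: "v \<in> verts A"
  obtains d where "conn v d" "\<And>w. conn v w \<Longrightarrow> par w \<subseteq> par d \<and> (w = d \<or> w \<sim> d)"
proof -
  let ?C = "{w. conn v w}"
  have "finite ?C" by (rule finite_subset[OF _ fin]) (use v conn_verts in auto)
  then obtain d where d: "d \<in> ?C" and "Max ((\<lambda>w. card (par w)) ` ?C) = card (par d)"
    using obtains_MAX[of ?C "\<lambda>w. card (par w)"] conn_refl by blast
  then have mx: "card (par w) \<le> card (par d)" if "conn v w" for w
    using that \<open>finite ?C\<close> by (metis Max_ge finite_imageI imageI mem_Collect_eq)
  have "par w \<subseteq> par d \<and> (w = d \<or> w \<sim> d)" if w: "conn v w" for w
  proof -
    have dw: "conn d w" using w d conn_sym conn_trans by blast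
    from conn_le_2[OF this] consider "d = w" | "d \<sim> w"
      | z where "d \<sim> z" "z \<sim> w" "lv z = lv d" "d \<noteq> w" "\<not> d \<sim> w" by blast
    then show ?thesis
    proof cases
      case 2
      have "par d = par w" if "par d \<subseteq> par w"
        using card_seteq[OF finite_par that] mx[OF w] by auto
      then show ?thesis using par_comparable[OF 2 conn_lv[OF dw]] 2 adj_sym by auto
    next
      case 3
      have lvw: "lv d = lv w" by (rule conn_lv[OF dw])
      have sub: "par d \<subseteq> par z" "par w \<subseteq> par z" "par d \<inter> par w = {}"
        using par_path3[of d z w] 3 lvw by auto
      have "conn v z" using 3 d conn_adj[of d z] conn_trans by auto
      then have "par z = par d" using card_seteq[OF finite_par sub(1)] mx by auto
      then have "par w = {}" using sub by auto
      moreover have "par w \<noteq> {}" using ex_common_parent[of z w] 3 lvw by auto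
      ultimately show ?thesis by simp
    qed auto
  qed
  then show thesis using that[of d] d by auto
qed

section \<open>Symmetric holes\<close>

text \<open>Both sides are indexed by the level, which aligns different holes with each other.\<close>

definition sym_hole :: "nat \<Rightarrow> nat \<Rightarrow> (nat \<Rightarrow> 'a) \<Rightarrow> (nat \<Rightarrow> 'a) \<Rightarrow> bool" where
  "sym_hole a j P Q \<longleftrightarrow> a + 2 \<le> j \<and> P j = Q j \<and> P a \<sim> Q a \<and>
     (\<forall>l \<in> {a..j}. lv (P l) = l \<and> lv (Q l) = l) \<and>
     (\<forall>l \<in> {a..<j}. P l \<sim> P (Suc l) \<and> Q l \<sim> Q (Suc l)) \<and>
     (\<forall>l \<in> {a<..<j}. P l \<noteq> Q l \<and> \<not> P l \<sim> Q l)"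

lemma sym_hole_swap: "sym_hole a j P Q \<Longrightarrow> sym_hole a j Q P"
  unfolding sym_hole_def by (metis adj_sym)

context
  fixes a j P Q
  assumes H: "sym_hole a j P Q"
begin

lemma sym_hole_bounds: "Suc a < j"
  using H by (simp add: sym_hole_def)

lemma sym_hole_bottom: "P j = Q j"
  using H by (simp add: sym_hole_def)

lemma sym_hole_top: "P a \<sim> Q a"
  using H by (simp add: sym_hole_def)

lemma sym_hole_lv: "a \<le> l \<Longrightarrow> l \<le> j \<Longrightarrow> lv (P l) = l" "a \<le> l \<Longrightarrow> l \<le> j \<Longrightarrow> lv (Q l) = l"
  using H by (auto simp: sym_hole_def)

lemma sym_hole_inj: "a \<le> s \<Longrightarrow> s \<le> j \<Longrightarrow> a \<le> t \<Longrightarrow> t \<le> j \<Longrightarrow> P s = P t \<longleftrightarrow> s = t"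
  by (metis sym_hole_lv(1))

lemma sym_hole_adj: "a \<le> l \<Longrightarrow> l < j \<Longrightarrow> P l \<sim> P (Suc l)" "a \<le> l \<Longrightarrow> l < j \<Longrightarrow> Q l \<sim> Q (Suc l)"
  using H by (auto simp: sym_hole_def)

lemma sym_hole_par:
  assumes "a \<le> l" "l < j"
  shows "P l \<in> par (P (Suc l))" "Q l \<in> par (Q (Suc l))"
  using sym_hole_adj[OF assms] sym_hole_lv[of l] sym_hole_lv[of "Suc l"] assms
    by (auto intro!: parI)

lemma sym_hole_neq: "a < l \<Longrightarrow> l < j \<Longrightarrow> P l \<noteq> Q l"
  using H by (auto simp: sym_hole_def)

lemma sym_hole_nadj: "a < l \<Longrightarrow> l < j \<Longrightarrow> \<not> P l \<sim> Q l"
  using H by (auto simp: sym_hole_def)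

lemma sym_hole_verts:
  assumes "a \<le> l" "l \<le> j"
  shows "P l \<in> verts A" "Q l \<in> verts A"
proof -
  have "P l \<sim> P (Suc l) \<and> Q l \<sim> Q (Suc l) \<or> P (l - 1) \<sim> P l \<and> Q (l - 1) \<sim> Q l"
    using sym_hole_adj[of l] sym_hole_adj[of "l - 1"] assms sym_hole_bounds by (cases "l = j") auto
  then show "P l \<in> verts A" "Q l \<in> verts A" using adj_verts by blast+
qed

lemma sym_hole_no_common_parent:
  assumes "a < l" "l < j" "p \<in> par (P l)" "p \<in> par (Q l)"
  shows False
  using siblings[OF assms(3,4)] sym_hole_neq sym_hole_nadj assms by blast

lemma sym_hole_adj_P:
  assumes "a \<le> s" "s \<le> j" "a \<le> t" "t \<le> j"
  shows "P s \<sim> P t \<longleftrightarrow> t = Suc s \<or> s = Suc t"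
proof
  assume st: "P s \<sim> P t"
  have "t \<le> Suc s" "s \<le> Suc t" using lv_step[OF st] lv_step[OF adj_sym[OF st]] sym_hole_lv assms
    by auto
  moreover have "s \<noteq> t" using st adj_irrefl by auto
  ultimately show "t = Suc s \<or> s = Suc t" by auto
next
  assume "t = Suc s \<or> s = Suc t"
  then show "P s \<sim> P t" using sym_hole_adj assms adj_sym by auto
qed

text \<open>Nonadjacency of the two sides on different levels is not part of
  \<open>sym_hole\<close>. It follows because an edge between consecutive levels of different sides
  would create a common parent of two vertices facing each other, hence make them equal or
  adjacent.\<close>

lemma sym_hole_cross:
  assumes "a < s" "s < j" "a < t" "t \<le> j"
  shows "P s \<noteq> Q t" "P s \<sim> Q t \<longleftrightarrow> Suc s = j \<and> t = j"
proof -
  show "P s \<noteq> Q t" using sym_hole_neq sym_hole_lv assms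
    by (metis less_imp_le_nat)
  show "P s \<sim> Q t \<longleftrightarrow> Suc s = j \<and> t = j"
  proof
    assume st: "P s \<sim> Q t"
    then have "P s \<in> par (Q t) \<or> s = t \<or> Q t \<in> par (P s)"
      using lv_step[OF st] lv_step[OF adj_sym[OF st]] sym_hole_lv assms adj_sym
      by (auto simp: par_def)
    then show "Suc s = j \<and> t = j"
    proof (elim disjE)
      assume p: "P s \<in> par (Q t)"
      then have t: "t = Suc s" using sym_hole_lv assms by (auto simp: par_def)
      then show ?thesis using sym_hole_no_common_parent[of t "P s"] sym_hole_par[of s] assms p
        by (cases "t < j") auto
    next
      assume p: "Q t \<in> par (P s)"
      then have "s = Suc t" using sym_hole_lv assms by (auto simp: par_def)
      then show ?thesis using sym_hole_no_common_parent[of s "Q t"] sym_hole_par[of t] assms p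
        by auto
    qed (use st sym_hole_nadj assms in auto)
  next
    assume "Suc s = j \<and> t = j"
    then show "P s \<sim> Q t" using sym_hole_adj(1)[of s] sym_hole_bottom assms by auto
  qed
qed

lemma induced_path_side:
  assumes "a \<le> l" "k \<le> Suc j"
  shows "induced_path A (map P [l..<k])"
proof -
  have "distinct (map P [l..<k])"
    using assms by (auto simp: distinct_map intro!: inj_on_inverseI[of _ lv] sym_hole_lv)
  moreover have "set (map P [l..<k]) \<subseteq> verts A" using assms sym_hole_verts by auto
  moreover have "map P [l..<k] ! i \<sim> map P [l..<k] ! i' \<longleftrightarrow> i' = Suc i \<or> i = Suc i'"
    if "i < length (map P [l..<k])" "i' < length (map P [l..<k])" for i i'
    using sym_hole_adj_P[of "l + i" "l + i'"] assms that by simp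
  ultimately show ?thesis unfolding induced_path_def by blast
qed

end

text \<open>The lower part of a hole, walked down \<open>P\<close> and up \<open>Q\<close>. The
  bottom vertex is contributed by \<open>Q\<close> only. The two sides have separate cutting levels
  because two holes may part on different levels on their two sides.\<close>

definition vpath :: "(nat \<Rightarrow> 'a) \<Rightarrow> (nat \<Rightarrow> 'a) \<Rightarrow> nat \<Rightarrow> nat \<Rightarrow> nat \<Rightarrow> 'a list" where
  "vpath P Q l l' j = map P [l..<j] @ rev (map Q [l'..<Suc j])"

lemma set_vpath: "l' \<le> j \<Longrightarrow> set (vpath P Q l l' j) = P ` {l..<j} \<union> Q ` {l'..j}"
  by (auto simp: vpath_def image_iff le_less)

lemma length_vpath: "l \<le> j \<Longrightarrow> l' \<le> j \<Longrightarrow> length (vpath P Q l l' j) = (j - l) + (Suc j - l')"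
  by (simp add: vpath_def del: upt_Suc)

lemma hd_vpath: "l < j \<Longrightarrow> hd (vpath P Q l l' j) = P l"
  by (simp add: vpath_def hd_append hd_map del: upt_Suc)

lemma last_vpath: "l' \<le> j \<Longrightarrow> last (vpath P Q l l' j) = Q l'"
  by (simp add: vpath_def last_append last_rev hd_map del: upt_Suc)

lemma induced_path_vpath:
  assumes H: "sym_hole a j P Q" and l: "a < l" "l < j" "a < l'" "l' \<le> j"
  shows "induced_path A (vpath P Q l l' j)"
  unfolding vpath_def
proof (rule induced_path_append[OF sym_edges])
  show "induced_path A (map P [l..<j])" using induced_path_side[OF H] l by simp
  show "induced_path A (rev (map Q [l'..<Suc j]))"
    using induced_path_rev[OF induced_path_side[OF sym_hole_swap[OF H]]] l
    by (simp del: upt_Suc)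
  fix x y assume xy: "x \<in> set (map P [l..<j])" "y \<in> set (rev (map Q [l'..<Suc j]))"
  then obtain s t where st: "x = P s" "l \<le> s" "s < j" "y = Q t" "l' \<le> t" "t \<le> j" by auto
  have "last (map P [l..<j]) = P (j - 1)" "hd (rev (map Q [l'..<Suc j])) = Q j"
    using l by (simp_all add: last_map hd_rev)
  moreover have "P s = P (j - 1) \<longleftrightarrow> s = j - 1" "Q t = Q j \<longleftrightarrow> t = j"
    using sym_hole_inj[OF H, of s "j - 1"] sym_hole_inj[OF sym_hole_swap[OF H], of t j] st l
      by simp_all
  ultimately show "x \<noteq> y \<and> (x \<sim> y \<longleftrightarrow> x = last (map P [l..<j]) \<and> y = hd (rev (map Q [l'..<Suc j])))"
    using sym_hole_cross[OF H, of s t] st l by auto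
qed (use l in simp_all)

lemma vpath_ne: "vpath P Q l l' j = [] \<longleftrightarrow> j \<le> l \<and> j < l'"
  by (auto simp: vpath_def)

lemma length_vpath_ge: "l < j \<Longrightarrow> l' < j \<Longrightarrow> 3 \<le> length (vpath P Q l l' j)"
  by (simp add: length_vpath)

lemma odd_vpath: "l \<le> j \<Longrightarrow> odd (length (vpath P Q l l j))"
  by (simp add: length_vpath)

text \<open>A dominating vertex \<open>r\<close> of a common component would be adjacent to
  \<open>P l\<close> and \<open>Q l\<close>. It sees nothing else of the path that joins them
  through the bottom, so it closes this odd path to an even cycle.\<close>

lemma sides_not_conn:
  assumes H: "sym_hole a j P Q" and l: "a < l" "Suc l < j"
  shows "\<not> conn (P l) (Q l)"
proof
  assume c: "conn (P l) (Q l)"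
  have lj: "l < j" using l by simp
  obtain r where r: "conn (P l) r" "\<And>w. conn (P l) w \<Longrightarrow> par w \<subseteq> par r \<and> (w = r \<or> w \<sim> r)"
    using dominating[of "P l"] sym_hole_verts[OF H, of l] l by auto
  note ne = sym_hole_neq[OF H l(1) lj] and na = sym_hole_nadj[OF H l(1) lj]
  have rP: "par (P l) \<subseteq> par r" "P l = r \<or> P l \<sim> r" and rQ: "par (Q l) \<subseteq> par r" "Q l = r \<or> Q l \<sim> r"
    using r(2)[of "P l"] r(2)[OF c] by auto
  have rne: "r \<noteq> P l" "r \<noteq> Q l" and radj: "r \<sim> P l" "r \<sim> Q l"
    using rP rQ ne na adj_sym by metis+
  have lvr: "lv r = l" using conn_lv[OF r(1)] sym_hole_lv[OF H, of l] l by simp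
  \<comment> \<open>Otherwise a common parent \<open>t\<close> of \<open>r\<close> and
    \<open>Q' l\<close>, together with \<open>P' l\<close> and \<open>Q' (Suc l)\<close>, forms a
    claw at \<open>r\<close>. This needs \<open>Suc l < j\<close>, because the bottom vertex is
    adjacent to both sides. The claim is stated for arbitrary sides so that it can also be used
    after a swap.\<close>
  have one_side: "\<not> r \<sim> Q' (Suc l)"
    if H': "sym_hole a j P' Q'"
      and r': "r \<sim> P' l" "r \<sim> Q' l" "par (Q' l) \<subseteq> par r" "par (P' l) \<subseteq> par r"
    for P' Q'
  proof
    assume rQ': "r \<sim> Q' (Suc l)"
    have lvs: "lv (P' l) = l" "lv (Q' (Suc l)) = Suc l" using sym_hole_lv[OF H'] l by auto
    then have "r \<in> par (Q' (Suc l))" using rQ' lvr by (auto intro: parI)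
    then have "\<not> r \<sim> P' (Suc l)"
      using sym_hole_no_common_parent[OF H', of "Suc l" r] l lvr sym_hole_lv[OF H', of "Suc l"]
        by (auto intro!: parI)
    have "par (Q' l) \<noteq> {}" using par_ne[of "Q' l"] sym_hole_verts[OF H', of l] sym_hole_lv[OF H', of
      l] l by auto
    then obtain t where t: "t \<in> par (Q' l)" "t \<in> par r" using r' by auto
    have "\<not> t \<sim> P' l"
      using sym_hole_no_common_parent[OF H' l(1) lj, of t] t lvr lvs by (auto simp: par_def)
    moreover have "\<not> P' l \<sim> Q' (Suc l)" "P' l \<noteq> Q' (Suc l)"
      using sym_hole_cross[OF H', of l "Suc l"] l by auto
    moreover have lvt: "Suc (lv t) = l" using t lvr by (auto simp: par_def)
    moreover have "\<not> t \<sim> Q' (Suc l)" "t \<noteq> P' l" "t \<noteq> Q' (Suc l)"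
      using lv_step[of t "Q' (Suc l)"] lvs lvt by auto
    ultimately show False
      using no_claw[of r t "P' l" "Q' (Suc l)"] rQ' r'(1) t lvs adj_sym by (auto simp: par_def)
  qed
  have nP: "\<not> r \<sim> Q (Suc l)" "\<not> r \<sim> P (Suc l)"
    using one_side[OF H] one_side[OF sym_hole_swap[OF H]] radj rP rQ by auto
  have "induced_cycle A ([r] @ vpath P Q l l j)"
  proof (rule induced_cycle_append[OF sym_edges _ induced_path_vpath[OF H]])
    show "induced_path A [r]" using induced_path_singleton[OF irr] adj_verts radj by blast
    fix x y assume x: "x \<in> set [r]" and y: "y \<in> set (vpath P Q l l j)"
    have far: "\<not> r \<sim> P t \<and> \<not> r \<sim> Q t \<and> r \<noteq> P t \<and> r \<noteq> Q t" if "l < t" "t \<le> j" for t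
    proof (cases "t = Suc l")
      case True
      then show ?thesis using nP lvr sym_hole_lv[OF H, of t] l that by auto
    next
      case False
      then show ?thesis using lv_step[of r "P t"] lv_step[of r "Q t"] lvr sym_hole_lv[OF H, of t] l
        that by auto
    qed
    obtain t where t: "l \<le> t" "t \<le> j" "y = P t \<or> y = Q t" using y lj by (auto simp: set_vpath)
    show "x \<noteq> y \<and> (x \<sim> y \<longleftrightarrow> x = last [r] \<and> y = hd (vpath P Q l l j) \<or> x = hd [r] \<and>
      y = last (vpath P Q l l j))"
    proof (cases "t = l")
      case True
      then show ?thesis using x t(3) rne radj lj by (auto simp: hd_vpath last_vpath)
    next
      case False
      then have "lv y \<noteq> l" "\<not> r \<sim> y" "r \<noteq> y" using t far[of t] sym_hole_lv[OF H, of t] l by auto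
      then have "y \<noteq> P l" "y \<noteq> Q l" "\<not> r \<sim> y" "r \<noteq> y" using sym_hole_lv[OF H, of l] l by auto
      then show ?thesis using x lj by (simp add: hd_vpath last_vpath)
    qed
  qed (use l length_vpath_ge[of l j l P Q] in \<open>auto simp: vpath_ne\<close>)
  from odd_cycle[OF this] show False using odd_vpath[of l j P Q] length_vpath_ge[of l j l P Q] l
    by simp
qed

text \<open>Suppose that \<open>d\<close> has a parent outside \<open>par (P l)\<close>. Prepending
  \<open>d\<close> to the path from \<open>P l\<close> through the bottom to \<open>Q l\<close>
  gives an even number of vertices, and both ends have private parents, contrary to
  \<open>cap\<close>. The work lies in showing that \<open>d\<close> sees only \<open>P l\<close> on
  this path.\<close>

lemma par_subset_of_not_adj_child:
  assumes H: "sym_hole a j P Q" and l: "a < l" "l < j"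
    and d: "d \<sim> P l" "lv d = l" "\<not> d \<sim> P (Suc l)"
  shows "par d \<subseteq> par (P l)"
proof (rule ccontr)
  assume "\<not> ?thesis"
  then obtain p where p: "p \<in> par d" "p \<notin> par (P l)" by auto
  have lvs: "lv (P l) = l" "lv (Q l) = l" using sym_hole_lv[OF H] l by auto
  have dv: "d \<in> verts A" using d adj_verts by auto
  note ne = sym_hole_neq[OF H l] and na = sym_hole_nadj[OF H l]
  have dQ: "d \<noteq> Q l" using d na adj_sym by auto
  have dnQ: "\<not> d \<sim> Q l"
  proof
    assume dq: "d \<sim> Q l"
    \<comment> \<open>The sides can share a component only just above the bottom, and there
      \<open>d\<close>, \<open>P l\<close>, the bottom vertex and \<open>Q l\<close> would form an
      induced cycle of length four.\<close>
    then have "conn (P l) (Q l)" using d lvs conn_adj adj_sym conn_trans by metis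
    then have j: "j = Suc l" using sides_not_conn[OF H l(1)] l by (metis Suc_lessI)
    have "induced_path A (vpath P Q l l j)" using induced_path_vpath[OF H] l by auto
    then have "induced_cycle A ([d] @ vpath P Q l l j)"
    proof (rule induced_cycle_append[OF sym_edges induced_path_singleton[OF irr dv]])
      have "set (vpath P Q l l j) = {P l, P j, Q l}"
        using j sym_hole_bottom[OF H] by (auto simp: set_vpath atLeastAtMostSuc_conv)
      moreover have "P j \<noteq> d" using sym_hole_lv[OF H, of j] d l by auto
      moreover have "P j \<noteq> P l" "P j \<noteq> Q l" using sym_hole_lv[OF H, of j] lvs l by auto
      ultimately show "x \<noteq> y \<and> (x \<sim> y \<longleftrightarrow> x = last [d] \<and> y = hd (vpath P Q l l j) \<or> x = hd [d] \<and>
        y = last (vpath P Q l l j))"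
        if "x \<in> set [d]" "y \<in> set (vpath P Q l l j)" for x y
        using that d dq dQ j adj_irrefl by (auto simp: hd_vpath last_vpath)
    qed (use l length_vpath_ge[of l j l P Q] in \<open>auto simp: vpath_ne\<close>)
    from odd_cycle[OF this] show False using odd_vpath[of l j P Q] length_vpath_ge[of l j l P Q] l
      by simp
  qed
  have dnQ': "\<not> d \<sim> Q (Suc l)"
  proof
    assume dq: "d \<sim> Q (Suc l)"
    have sl: "Suc l \<noteq> j" using dq d sym_hole_bottom[OF H] by auto
    have "Q l \<sim> Q (Suc l)" "Q (Suc l) \<sim> Q (Suc (Suc l))" using sym_hole_adj[OF H] l sl by auto
    moreover have "lv (Q (Suc (Suc l))) = Suc (Suc l)" using sym_hole_lv[OF H] l sl by auto
    moreover have "\<not> d \<sim> Q (Suc (Suc l))" "\<not> Q l \<sim> Q (Suc (Suc l))"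
      using lv_step calculation(3) d lvs by fastforce+
    moreover have "d \<noteq> Q (Suc (Suc l))" "Q l \<noteq> Q (Suc (Suc l))"
      using calculation(3) d lvs by auto
    ultimately show False using no_claw[of "Q (Suc l)" d "Q l" "Q (Suc (Suc l))"] dq dnQ dQ d lvs
      adj_sym by auto
  qed
  have far: "\<not> d \<sim> P t \<and> \<not> d \<sim> Q t \<and> d \<noteq> P t \<and> d \<noteq> Q t" if "l < t" "t \<le> j" for t
  proof (cases "t = Suc l")
    case True
    then show ?thesis using d dnQ' sym_hole_lv[OF H, of t] l that by auto
  next
    case False
    then show ?thesis using lv_step[of d "P t"] lv_step[of d "Q t"] d sym_hole_lv[OF H, of t] l that
      by auto
  qed
  have path: "induced_path A ([d] @ vpath P Q l l j)"
  proof (rule induced_path_append[OF sym_edges induced_path_singleton[OF irr dv]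
    induced_path_vpath[OF H]])
    fix x y assume x: "x \<in> set [d]" and y: "y \<in> set (vpath P Q l l j)"
    obtain t where t: "l \<le> t" "t \<le> j" "y = P t \<or> y = Q t" using y l by (auto simp: set_vpath)
    show "x \<noteq> y \<and> (x \<sim> y \<longleftrightarrow> x = last [d] \<and> y = hd (vpath P Q l l j))"
    proof (cases "t = l")
      case True
      then show ?thesis using x t(3) d dQ dnQ l ne adj_irrefl by (auto simp: hd_vpath)
    next
      case False
      then have "lv y \<noteq> l" "\<not> d \<sim> y" "d \<noteq> y" using t far[of t] sym_hole_lv[OF H, of t] l by auto
      then have "y \<noteq> P l" "\<not> d \<sim> y" "d \<noteq> y" using lvs by auto
      then show ?thesis using x l by (simp add: hd_vpath)
    qed
  qed (use l length_vpath_ge[of l j l P Q] in \<open>auto simp: vpath_ne\<close>)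
  obtain q where q: "q \<in> par (Q l)" using par_ne[of "Q l"] sym_hole_verts[OF H, of l] lvs l by auto
  have close: "t = l" if "u \<sim> P t \<or> u \<sim> Q t" "lv u < l" "l \<le> t" "t \<le> j" for u t
    using that lv_step[of u "P t"] lv_step[of u "Q t"] sym_hole_lv[OF H, of t] l by auto
  have lvpq: "Suc (lv p) = l" "Suc (lv q) = l" using p q d lvs by (auto simp: par_def)
  let ?xs = "[d] @ vpath P Q l l j"
  have hd_last: "hd ?xs = d" "last ?xs = Q l" using l
    by (simp_all add: last_append vpath_ne last_vpath)
  have mem: "\<exists>t. l \<le> t \<and> t \<le> j \<and> (x = P t \<or> x = Q t)" if "x \<in> set ?xs" "x \<noteq> d" for x
    using that l by (auto simp: set_vpath)
  have near: "x = d \<or> x = P l \<or> x = Q l" if "x \<in> set ?xs" "u \<sim> x" "lv u < l" for u x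
    using mem[OF that(1)] close[of u] that(2,3) by metis
  have nbrs: "\<not> p \<sim> P l" "\<not> p \<sim> Q l" "\<not> q \<sim> P l" "\<not> q \<sim> d"
    using p q siblings[of p d "Q l"] siblings[of q "P l" "Q l"] siblings[of q d "Q l"]
      dQ dnQ ne na lvs d by (auto simp: par_def)
  have "odd (length ?xs)"
  proof (rule cap[OF path, of l p q])
    show "\<forall>x \<in> set ?xs. l \<le> lv x"
    proof
      fix x assume "x \<in> set ?xs"
      then show "l \<le> lv x" using mem[of x] d(2) sym_hole_lv[OF H] l
        by (metis le_trans less_imp_le_nat order_refl)
    qed
    show "\<forall>x \<in> set ?xs. p \<sim> x \<longrightarrow> x = hd ?xs"
      unfolding hd_last using near[of _ p] nbrs lvpq by (metis lessI)
    show "\<forall>x \<in> set ?xs. q \<sim> x \<longrightarrow> x = last ?xs"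
      unfolding hd_last using near[of _ q] nbrs lvpq by (metis lessI)
  qed (use l d p q lvs hd_last in \<open>simp_all add: length_vpath\<close>)
  then show False using l odd_vpath[of l j P Q] by simp
qed

text \<open>A dominating vertex collects all parents of the component. Either it has the child
  \<open>P (Suc l)\<close> itself, or its parents are among those of \<open>P l\<close>, which has
  this child. In both cases a child excludes nonadjacent parents.\<close>

lemma intermediate_par_clique:
  assumes H: "sym_hole a j P Q" and l: "a < l" "l < j"
    and w: "conn (P l) w" "s \<in> par w" "t \<in> par w"
  shows "s = t \<or> s \<sim> t"
proof -
  have lvs: "lv (P l) = l" "lv (P (Suc l)) = Suc l" using sym_hole_lv[OF H] l by auto
  obtain d where d: "conn (P l) d" "par w \<subseteq> par d" "P l = d \<or> P l \<sim> d"
    using dominating[of "P l"] sym_hole_verts[OF H, of l] l w(1)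
      by (metis conn_refl less_imp_le_nat)
  have st: "s \<in> par d" "t \<in> par d" "lv d = l" using w d conn_lv[OF d(1)] lvs by auto
  \<comment> \<open>The child is two levels away from the parents of \<open>c\<close>, so two
    nonadjacent parents and the child would form a claw at \<open>c\<close>.\<close>
  have clique: "s = t \<or> s \<sim> t" if "c \<sim> P (Suc l)" "s \<in> par c" "t \<in> par c" "lv c = l" for c
  proof -
    have "\<not> s \<sim> P (Suc l)" "\<not> t \<sim> P (Suc l)" "s \<noteq> P (Suc l)" "t \<noteq> P (Suc l)"
      using that lvs lv_step by (fastforce simp: par_def)+
    then show ?thesis using no_claw[of c s t "P (Suc l)"] that adj_sym by (auto simp: par_def)
  qed
  have PP: "P l \<sim> P (Suc l)" using sym_hole_adj[OF H] l by auto
  show ?thesis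
  proof (cases "d \<sim> P (Suc l)")
    case True
    then show ?thesis using clique st by auto
  next
    case False
    then have "d \<sim> P l" using d(3) PP adj_sym by auto
    from par_subset_of_not_adj_child[OF H l this st(3) False] show ?thesis
      using clique[OF PP] st lvs by auto
  qed
qed

text \<open>All parents of the component are parents of one dominating vertex, \<open>P l\<close> is
  among them, and they form a clique. Going up from an intermediate component is thus
  deterministic.\<close>

lemma intermediate_par_conn:
  assumes H: "sym_hole a j P Q" and l: "a \<le> l" "Suc l < j" and w: "conn (P (Suc l)) w" "s \<in> par w"
  shows "conn (P l) s"
proof -
  have lvs: "lv (P l) = l" "lv (P (Suc l)) = Suc l" using sym_hole_lv[OF H] l by auto
  obtain d where d: "conn (P (Suc l)) d" "par w \<subseteq> par d" "par (P (Suc l)) \<subseteq> par d"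
    using dominating[of "P (Suc l)"] sym_hole_verts[OF H, of "Suc l"] l w(1)
      by (metis conn_refl le_SucI less_imp_le_nat)
  then have "P l \<in> par d" "s \<in> par d" using sym_hole_par[OF H] l w by auto
  then show ?thesis
    using intermediate_par_clique[OF H _ _ d(1), of "P l" s] l conn_adj[of "P l" s]
      by (auto simp: par_def)
qed

text \<open>A dominating vertex of the bottom component has the two nonadjacent parents
  \<open>P l\<close> and \<open>Q l\<close>; to avoid a claw, each further parent is adjacent to one
  of them.\<close>

lemma bottom_par_conn:
  assumes H: "sym_hole a (Suc l) P Q" and w: "conn (P (Suc l)) w" "s \<in> par w"
  shows "conn (P l) s \<or> conn (Q l) s"
proof -
  have l: "a < l" using sym_hole_bounds[OF H] by simp
  obtain d where d: "conn (P (Suc l)) d" "par w \<subseteq> par d" "par (P (Suc l)) \<subseteq> par d"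
    using dominating[of "P (Suc l)"] sym_hole_verts[OF H, of "Suc l"] l w(1)
      by (metis conn_refl le_SucI less_imp_le_nat order_refl)
  then have pq: "P l \<in> par d" "Q l \<in> par d" "s \<in> par d"
    using sym_hole_par[OF H, of l] sym_hole_bottom[OF H] l w by auto
  then have "s = P l \<or> s = Q l \<or> s \<sim> P l \<or> s \<sim> Q l"
    using no_claw[of d "P l" "Q l" s] sym_hole_neq[OF H, of l] sym_hole_nadj[OF H, of l] l adj_sym
      by (auto simp: par_def)
  then show ?thesis using pq conn_adj[of s "P l"] conn_adj[of s "Q l"] conn_sym
    by (auto simp: par_def)
qed

section \<open>Two holes sharing a component\<close>

text \<open>Otherwise a dominating vertex \<open>r\<close> is adjacent to both vertices and has the
  parents of both. These are disjoint nonempty sets, so by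
  \<open>par_subset_of_not_adj_child\<close> the children on both sides are children of
  \<open>r\<close>, and siblings lie in one component.\<close>

lemma shared_adj:
  assumes H1: "sym_hole a\<^sub>1 j\<^sub>1 P\<^sub>1 Q\<^sub>1" and H2: "sym_hole a\<^sub>2 j\<^sub>2 P\<^sub>2 Q\<^sub>2"
    and l: "a\<^sub>1 < l" "l < j\<^sub>1" "a\<^sub>2 < l" "l < j\<^sub>2"
    and c: "conn (P\<^sub>1 l) (P\<^sub>2 l)" and nc: "\<not> conn (P\<^sub>1 (Suc l)) (P\<^sub>2 (Suc l))"
  shows "P\<^sub>1 l \<sim> P\<^sub>2 l"
proof (rule ccontr)
  assume na: "\<not> P\<^sub>1 l \<sim> P\<^sub>2 l"
  have child: "P\<^sub>1 l \<in> par (P\<^sub>1 (Suc l))" "P\<^sub>2 l \<in> par (P\<^sub>2 (Suc l))"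
    using sym_hole_par[OF H1, of l] sym_hole_par[OF H2, of l] l by auto
  have ne: "P\<^sub>1 l \<noteq> P\<^sub>2 l" using siblings_conn[of "P\<^sub>1 l"] child nc by metis
  have lvs: "lv (P\<^sub>1 l) = l" "lv (P\<^sub>2 l) = l" "lv (P\<^sub>1 (Suc l)) = Suc l" "lv (P\<^sub>2 (Suc l)) = Suc l"
    using sym_hole_lv[OF H1] sym_hole_lv[OF H2] l by auto
  have v: "P\<^sub>1 l \<in> verts A" "P\<^sub>2 l \<in> verts A" using sym_hole_verts[OF H1] sym_hole_verts[OF H2] l
    by auto
  obtain r where r: "conn (P\<^sub>1 l) r" "\<And>w. conn (P\<^sub>1 l) w \<Longrightarrow> par w \<subseteq> par r \<and> (w = r \<or> w \<sim> r)"
    using dominating[OF v(1)] by blast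
  have sub: "par (P\<^sub>1 l) \<subseteq> par r" "par (P\<^sub>2 l) \<subseteq> par r" using r(2)[OF c] r(2)[OF conn_refl] by auto
  have adj: "r \<sim> P\<^sub>1 l" "r \<sim> P\<^sub>2 l" using r(2)[OF c] r(2)[OF conn_refl] ne na adj_sym by metis+
  have lvr: "lv r = l" using conn_lv[OF r(1)] lvs by simp
  have disj: "par (P\<^sub>1 l) \<inter> par (P\<^sub>2 l) = {}" using siblings[of _ "P\<^sub>1 l" "P\<^sub>2 l"] ne na by blast
  have "par (P\<^sub>1 l) \<noteq> {}" "par (P\<^sub>2 l) \<noteq> {}" using par_ne v lvs l by auto
  then have "\<not> par r \<subseteq> par (P\<^sub>1 l)" "\<not> par r \<subseteq> par (P\<^sub>2 l)" using sub disj by auto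
  then have "r \<sim> P\<^sub>1 (Suc l)" "r \<sim> P\<^sub>2 (Suc l)"
    using par_subset_of_not_adj_child[OF H1 l(1,2) adj(1) lvr]
      par_subset_of_not_adj_child[OF H2 l(3,4) adj(2) lvr] by auto
  then show False using siblings_conn[of r] nc lvs lvr parI by metis
qed

text \<open>A bottom vertex has two nonadjacent parents, whereas the parents of any vertex in an
  intermediate component form a clique.\<close>

lemma bottom_not_intermediate:
  assumes H1: "sym_hole a\<^sub>1 j\<^sub>1 P\<^sub>1 Q\<^sub>1" and H2: "sym_hole a\<^sub>2 j\<^sub>2 P\<^sub>2 Q\<^sub>2"
    and l: "a\<^sub>1 < j\<^sub>2" "j\<^sub>2 < j\<^sub>1"
  shows "\<not> conn (P\<^sub>1 j\<^sub>2) (P\<^sub>2 j\<^sub>2)"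
proof
  assume c: "conn (P\<^sub>1 j\<^sub>2) (P\<^sub>2 j\<^sub>2)"
  obtain k where k: "j\<^sub>2 = Suc k" "a\<^sub>2 < k" using sym_hole_bounds[OF H2] by (cases j\<^sub>2) auto
  then have "P\<^sub>2 k \<in> par (P\<^sub>2 j\<^sub>2)" "Q\<^sub>2 k \<in> par (P\<^sub>2 j\<^sub>2)"
    using sym_hole_par[OF H2, of k] sym_hole_bottom[OF H2] by auto
  then show False
    using intermediate_par_clique[OF H1 l c] sym_hole_neq[OF H2, of k] sym_hole_nadj[OF H2, of k] k
      by blast
qed

text \<open>Sharing is inherited upward, since the parents of an intermediate component lie in one
  component. The strict bound \<open>t < j\<^sub>1\<close> makes the components of the first hole
  intermediate; in the second hole \<open>t\<close> may be the bottom level.\<close>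

lemma shared_ancestors:
  assumes H1: "sym_hole a\<^sub>1 j\<^sub>1 P\<^sub>1 Q\<^sub>1" and H2: "sym_hole a\<^sub>2 j\<^sub>2 P\<^sub>2 Q\<^sub>2"
    and t: "conn (P\<^sub>1 t) (P\<^sub>2 t)" "t < j\<^sub>1" "t \<le> j\<^sub>2"
    and l: "a\<^sub>1 \<le> l" "a\<^sub>2 \<le> l" "l \<le> t"
  shows "conn (P\<^sub>1 l) (P\<^sub>2 l)"
  using l(3)
proof (induction rule: inc_induct)
  case (step n)
  then show ?case
    using intermediate_par_conn[OF H1, of n "P\<^sub>2 (Suc n)" "P\<^sub>2 n"] sym_hole_par[OF H2, of n] t l
      by auto
qed (rule t)

lemma shared_above_bottom:
  assumes H1: "sym_hole a\<^sub>1 j\<^sub>1 P\<^sub>1 Q\<^sub>1" and H2: "sym_hole a\<^sub>2 j\<^sub>2 P\<^sub>2 Q\<^sub>2"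
    and t: "conn (P\<^sub>1 t) (P\<^sub>2 t)" "a\<^sub>1 < t" "t \<le> j\<^sub>1" "a\<^sub>2 < t" "t \<le> j\<^sub>2"
    and nb: "\<not> conn (P\<^sub>1 j\<^sub>1) (P\<^sub>2 j\<^sub>2)"
  shows "t < j\<^sub>1" "t < j\<^sub>2"
proof -
  have "\<not> (t = j\<^sub>1 \<and> t < j\<^sub>2)"
  proof
    assume "t = j\<^sub>1 \<and> t < j\<^sub>2"
    then show False using bottom_not_intermediate[OF H2 H1] t(4) conn_sym[OF t(1)] by simp
  qed
  moreover have "\<not> (t = j\<^sub>2 \<and> t < j\<^sub>1)"
  proof
    assume "t = j\<^sub>2 \<and> t < j\<^sub>1"
    then show False using bottom_not_intermediate[OF H1 H2] t(1,2) by simp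
  qed
  moreover have "\<not> (t = j\<^sub>1 \<and> t = j\<^sub>2)" using t(1) nb by auto
  ultimately show "t < j\<^sub>1" "t < j\<^sub>2" using t(3,5) by linarith+
qed

section \<open>Holes with a common bottom component\<close>

definition same_shape :: "nat \<Rightarrow> nat \<Rightarrow> (nat \<Rightarrow> 'a) \<Rightarrow> (nat \<Rightarrow> 'a) \<Rightarrow> (nat \<Rightarrow> 'a) \<Rightarrow> (nat \<Rightarrow> 'a) \<Rightarrow> bool"
  where
  "same_shape a j P\<^sub>1 Q\<^sub>1 P\<^sub>2 Q\<^sub>2 \<longleftrightarrow> (\<forall>l \<in> {a..j}. conn (P\<^sub>1 l) (P\<^sub>2 l) \<and> conn (Q\<^sub>1 l) (Q\<^sub>2 l))"

text \<open>If the first hole reached higher, the sides of the second would already meet on level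
  \<open>a\<^sub>2\<close>. Through the shared components the sides of the first hole would meet
  there too, contrary to \<open>sides_not_conn\<close>.\<close>

lemma shared_sides_top_le:
  assumes H1: "sym_hole a\<^sub>1 (Suc k) P\<^sub>1 Q\<^sub>1" and H2: "sym_hole a\<^sub>2 (Suc k) P\<^sub>2 Q\<^sub>2"
    and c: "conn (P\<^sub>1 k) (P\<^sub>2 k)" "conn (Q\<^sub>1 k) (Q\<^sub>2 k)"
  shows "a\<^sub>2 \<le> a\<^sub>1"
proof (rule ccontr)
  assume less: "\<not> a\<^sub>2 \<le> a\<^sub>1"
  have k: "a\<^sub>1 < k" "a\<^sub>2 < k" using sym_hole_bounds[OF H1] sym_hole_bounds[OF H2] by auto
  have "conn (P\<^sub>1 a\<^sub>2) (P\<^sub>2 a\<^sub>2)" "conn (Q\<^sub>1 a\<^sub>2) (Q\<^sub>2 a\<^sub>2)"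
    using shared_ancestors[OF H1 H2 c(1), of a\<^sub>2]
      shared_ancestors[OF sym_hole_swap[OF H1] sym_hole_swap[OF H2] c(2), of a\<^sub>2] k less by auto
  moreover have "conn (P\<^sub>2 a\<^sub>2) (Q\<^sub>2 a\<^sub>2)"
    using conn_adj[OF sym_hole_top[OF H2]] sym_hole_lv[OF H2, of a\<^sub>2] k by simp
  ultimately have "conn (P\<^sub>1 a\<^sub>2) (Q\<^sub>1 a\<^sub>2)" using conn_trans conn_sym by metis
  then show False using sides_not_conn[OF H1, of a\<^sub>2] less k by simp
qed

lemma shared_sides:
  assumes H1: "sym_hole a\<^sub>1 (Suc k) P\<^sub>1 Q\<^sub>1" and H2: "sym_hole a\<^sub>2 (Suc k) P\<^sub>2 Q\<^sub>2"
    and c: "conn (P\<^sub>1 k) (P\<^sub>2 k)" "conn (Q\<^sub>1 k) (Q\<^sub>2 k)" "conn (P\<^sub>1 (Suc k)) (P\<^sub>2 (Suc k))"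
  shows "a\<^sub>1 = a\<^sub>2" "same_shape a\<^sub>1 (Suc k) P\<^sub>1 Q\<^sub>1 P\<^sub>2 Q\<^sub>2"
proof -
  show a: "a\<^sub>1 = a\<^sub>2"
    using shared_sides_top_le[OF H1 H2 c(1,2)] shared_sides_top_le[OF H2 H1 conn_sym[OF c(1)]
      conn_sym[OF c(2)]]
    by simp
  have "conn (P\<^sub>1 l) (P\<^sub>2 l) \<and> conn (Q\<^sub>1 l) (Q\<^sub>2 l)" if "a\<^sub>1 \<le> l" "l \<le> Suc k" for l
  proof (cases "l = Suc k")
    case True
    then show ?thesis using c(3) sym_hole_bottom[OF H1] sym_hole_bottom[OF H2] by simp
  next
    case False
    then show ?thesis
      using shared_ancestors[OF H1 H2 c(1), of l] that a
        shared_ancestors[OF sym_hole_swap[OF H1] sym_hole_swap[OF H2] c(2), of l] by auto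
  qed
  then show "same_shape a\<^sub>1 (Suc k) P\<^sub>1 Q\<^sub>1 P\<^sub>2 Q\<^sub>2" by (simp add: same_shape_def)
qed

lemma shared_bottom:
  assumes H1: "sym_hole a\<^sub>1 j\<^sub>1 P\<^sub>1 Q\<^sub>1" and H2: "sym_hole a\<^sub>2 j\<^sub>2 P\<^sub>2 Q\<^sub>2"
    and c: "conn (P\<^sub>1 j\<^sub>1) (P\<^sub>2 j\<^sub>2)"
  shows "a\<^sub>1 = a\<^sub>2 \<and> j\<^sub>1 = j\<^sub>2 \<and>
    (same_shape a\<^sub>1 j\<^sub>1 P\<^sub>1 Q\<^sub>1 P\<^sub>2 Q\<^sub>2 \<or> same_shape a\<^sub>1 j\<^sub>1 P\<^sub>1 Q\<^sub>1 Q\<^sub>2 P\<^sub>2)"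
proof -
  have j: "j\<^sub>1 = j\<^sub>2"
    using conn_lv[OF c] sym_hole_lv(1)[OF H1, of j\<^sub>1] sym_hole_lv(1)[OF H2, of j\<^sub>2]
      sym_hole_bounds[OF H1] sym_hole_bounds[OF H2] by auto
  obtain k where k: "j\<^sub>1 = Suc k" "a\<^sub>1 < k" "a\<^sub>2 < k"
    using sym_hole_bounds[OF H1] sym_hole_bounds[OF H2] j by (cases j\<^sub>1) auto
  have H1': "sym_hole a\<^sub>1 (Suc k) P\<^sub>1 Q\<^sub>1" and H2': "sym_hole a\<^sub>2 (Suc k) P\<^sub>2 Q\<^sub>2"
    and c': "conn (P\<^sub>1 (Suc k)) (P\<^sub>2 (Suc k))" "conn (P\<^sub>2 (Suc k)) (P\<^sub>1 (Suc k))"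
    using H1 H2 c conn_sym[OF c] j k by auto
  have par1: "P\<^sub>1 k \<in> par (P\<^sub>1 (Suc k))" "Q\<^sub>1 k \<in> par (P\<^sub>1 (Suc k))"
    and par2: "P\<^sub>2 k \<in> par (P\<^sub>2 (Suc k))" "Q\<^sub>2 k \<in> par (P\<^sub>2 (Suc k))"
    using sym_hole_par[OF H1', of k] sym_hole_bottom[OF H1'] sym_hole_par[OF H2', of k]
      sym_hole_bottom[OF H2'] k by auto
  \<comment> \<open>Every parent on either hole lies in the component of some parent on the other
    hole. Having this in both directions yields a one-to-one matching, straight or crossed, even if
    all four lie in one component.\<close>
  have "conn (P\<^sub>1 k) (P\<^sub>2 k) \<and> conn (Q\<^sub>1 k) (Q\<^sub>2 k) \<or> conn (P\<^sub>1 k) (Q\<^sub>2 k) \<and> conn (Q\<^sub>1 k) (P\<^sub>2 k)"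
    using bottom_par_conn[OF H1' c'(1) par2(1)] bottom_par_conn[OF H1' c'(1) par2(2)]
      bottom_par_conn[OF H2' c'(2) par1(1)] bottom_par_conn[OF H2' c'(2) par1(2)] conn_sym
        conn_trans
    by metis
  then show ?thesis
    using shared_sides[OF H1' H2' _ _ c'(1)] shared_sides[OF H1' sym_hole_swap[OF H2']] c'(1)
      sym_hole_bottom[OF H2'] j k
    by metis
qed

section \<open>Contacts between the lower parts of two holes\<close>

lemma child_of_shared:
  assumes H1: "sym_hole a\<^sub>1 j\<^sub>1 P\<^sub>1 Q\<^sub>1" and s: "a\<^sub>1 \<le> s" "Suc s \<le> j\<^sub>1"
    and v: "P\<^sub>1 (Suc s) \<sim> v" "lv v = s"
  shows "v \<in> par (P\<^sub>1 (Suc s))" "conn (P\<^sub>1 s) v \<or> Suc s = j\<^sub>1 \<and> conn (Q\<^sub>1 s) v"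
proof -
  show p: "v \<in> par (P\<^sub>1 (Suc s))" using v sym_hole_lv(1)[OF H1, of "Suc s"] s adj_sym
    by (auto simp: par_def)
  show "conn (P\<^sub>1 s) v \<or> Suc s = j\<^sub>1 \<and> conn (Q\<^sub>1 s) v"
  proof (cases "Suc s = j\<^sub>1")
    case True
    then show ?thesis using bottom_par_conn[of a\<^sub>1 s P\<^sub>1 Q\<^sub>1 "P\<^sub>1 (Suc s)" v] p H1 by simp
  next
    case False
    then show ?thesis using intermediate_par_conn[OF H1 s(1), of "P\<^sub>1 (Suc s)" v] p s by simp
  qed
qed

text \<open>\<open>P\<^sub>2 s\<close> would be a parent of \<open>P\<^sub>1 (Suc s)\<close> and, as
  \<open>opp\<close> excludes the other side, lie in the component of \<open>P\<^sub>1 s\<close>.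
  This forces \<open>s = m\<close>. But then it is a common parent of the vertices of both holes on
  the next level, which \<open>same\<close> forbids to be connected.\<close>

lemma same_sides_apart_below:
  assumes H1: "sym_hole a\<^sub>1 j\<^sub>1 P\<^sub>1 Q\<^sub>1" and H2: "sym_hole a\<^sub>2 j\<^sub>2 P\<^sub>2 Q\<^sub>2"
    and m: "a\<^sub>1 < m" "m < j\<^sub>1" "a\<^sub>2 < m" "m < j\<^sub>2"
    and same: "\<And>t. m < t \<Longrightarrow> t \<le> j\<^sub>1 \<Longrightarrow> t \<le> j\<^sub>2 \<Longrightarrow> \<not> conn (P\<^sub>1 t) (P\<^sub>2 t)"
    and opp: "\<And>t. m \<le> t \<Longrightarrow> t \<le> j\<^sub>1 \<Longrightarrow> t \<le> j\<^sub>2 \<Longrightarrow> \<not> conn (Q\<^sub>1 t) (P\<^sub>2 t)"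
    and s: "m \<le> s" "Suc s \<le> j\<^sub>1" "s \<le> j\<^sub>2"
  shows "\<not> P\<^sub>1 (Suc s) \<sim> P\<^sub>2 s"
proof
  assume a: "P\<^sub>1 (Suc s) \<sim> P\<^sub>2 s"
  have "lv (P\<^sub>2 s) = s" using sym_hole_lv[OF H2] m s by auto
  with child_of_shared[OF H1 _ s(2) a] m s
  have p: "P\<^sub>2 s \<in> par (P\<^sub>1 (Suc s))" and "conn (P\<^sub>1 s) (P\<^sub>2 s) \<or> conn (Q\<^sub>1 s) (P\<^sub>2 s)" by auto
  then have "conn (P\<^sub>1 s) (P\<^sub>2 s)" using opp s by auto
  then have sm: "s = m" using same[of s] s by force
  then have "P\<^sub>2 s \<in> par (P\<^sub>2 (Suc s))" using sym_hole_par[OF H2, of s] m by auto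
  then show False using siblings_conn[OF p] same[of "Suc s"] m sm by auto
qed

lemma same_sides_apart:
  assumes H1: "sym_hole a\<^sub>1 j\<^sub>1 P\<^sub>1 Q\<^sub>1" and H2: "sym_hole a\<^sub>2 j\<^sub>2 P\<^sub>2 Q\<^sub>2"
    and m: "a\<^sub>1 < m" "m < j\<^sub>1" "a\<^sub>2 < m" "m < j\<^sub>2"
    and same: "\<And>t. m < t \<Longrightarrow> t \<le> j\<^sub>1 \<Longrightarrow> t \<le> j\<^sub>2 \<Longrightarrow> \<not> conn (P\<^sub>1 t) (P\<^sub>2 t)"
    and opp: "\<And>t. m \<le> t \<Longrightarrow> t \<le> j\<^sub>1 \<Longrightarrow> t \<le> j\<^sub>2 \<Longrightarrow> \<not> conn (Q\<^sub>1 t) (P\<^sub>2 t)"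
      "\<And>t. m \<le> t \<Longrightarrow> t \<le> j\<^sub>1 \<Longrightarrow> t \<le> j\<^sub>2 \<Longrightarrow> \<not> conn (P\<^sub>1 t) (Q\<^sub>2 t)"
    and ts: "m \<le> t" "t \<le> j\<^sub>1" "m \<le> s" "s \<le> j\<^sub>2" and near: "P\<^sub>1 t = P\<^sub>2 s \<or> P\<^sub>1 t \<sim> P\<^sub>2 s"
  shows "t = m \<and> s = m"
proof -
  have lvs: "lv (P\<^sub>1 t) = t" "lv (P\<^sub>2 s) = s"
    using sym_hole_lv[OF H1, of t] sym_hole_lv[OF H2, of s] m ts by auto
  then have "t = Suc s \<and> P\<^sub>1 t \<sim> P\<^sub>2 s \<or> s = Suc t \<and> P\<^sub>1 t \<sim> P\<^sub>2 s \<or> t = s"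
    using near lv_step[of "P\<^sub>1 t" "P\<^sub>2 s"] lv_step[OF adj_sym, of "P\<^sub>1 t" "P\<^sub>2 s"] by auto
  moreover have "\<not> (t = Suc s \<and> P\<^sub>1 t \<sim> P\<^sub>2 s)"
    using same_sides_apart_below[OF H1 H2 m same opp(1), of s] ts by auto
  moreover have "\<not> (s = Suc t \<and> P\<^sub>1 t \<sim> P\<^sub>2 s)"
    using same_sides_apart_below[OF H2 H1 m(3,4,1,2), of t] same opp(2) conn_sym ts adj_sym by blast
  ultimately have st: "t = s" by auto
  then have "conn (P\<^sub>1 t) (P\<^sub>2 t)" using near lvs conn_adj[of "P\<^sub>1 t" "P\<^sub>2 t"] by auto
  then show ?thesis using same[of t] st ts by force
qed

text \<open>The only component left for the parent \<open>Q\<^sub>2 s\<close> is that of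
  \<open>Q\<^sub>1 s\<close>, directly above the bottom of the first hole. The bottom vertex also
  belongs to \<open>Q\<^sub>1\<close>, so the argument for equal sides applies to
  \<open>Q\<^sub>1\<close> and \<open>Q\<^sub>2\<close>. The bounds \<open>m\<close> and
  \<open>n\<close> are separate because the two sides may be cut on different levels.\<close>

lemma opposite_sides_apart_below:
  assumes H1: "sym_hole a\<^sub>1 j\<^sub>1 P\<^sub>1 Q\<^sub>1" and H2: "sym_hole a\<^sub>2 j\<^sub>2 P\<^sub>2 Q\<^sub>2"
    and m: "a\<^sub>1 < m" "m < j\<^sub>1" "a\<^sub>2 < m" "m < j\<^sub>2"
    and same: "\<And>t. m < t \<Longrightarrow> t \<le> j\<^sub>1 \<Longrightarrow> t \<le> j\<^sub>2 \<Longrightarrow> \<not> conn (Q\<^sub>1 t) (Q\<^sub>2 t)"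
    and opp: "\<And>t. n \<le> t \<Longrightarrow> t \<le> j\<^sub>1 \<Longrightarrow> t \<le> j\<^sub>2 \<Longrightarrow> \<not> conn (P\<^sub>1 t) (Q\<^sub>2 t)"
    and s: "n \<le> s" "m \<le> s" "Suc s \<le> j\<^sub>1" "s \<le> j\<^sub>2"
  shows "\<not> P\<^sub>1 (Suc s) \<sim> Q\<^sub>2 s"
proof
  assume a: "P\<^sub>1 (Suc s) \<sim> Q\<^sub>2 s"
  have "lv (Q\<^sub>2 s) = s" using sym_hole_lv[OF H2] m s by auto
  with child_of_shared[OF H1 _ s(3) a] m s
  have p: "Q\<^sub>2 s \<in> par (P\<^sub>1 (Suc s))"
    and "conn (P\<^sub>1 s) (Q\<^sub>2 s) \<or> Suc s = j\<^sub>1 \<and> conn (Q\<^sub>1 s) (Q\<^sub>2 s)" by auto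
  then have c: "Suc s = j\<^sub>1" "conn (Q\<^sub>1 s) (Q\<^sub>2 s)" using opp s by auto
  then have sm: "s = m" using same[of s] s by force
  have "P\<^sub>1 (Suc s) = Q\<^sub>1 (Suc s)" using c(1) sym_hole_bottom[OF H1] by simp
  moreover have "Q\<^sub>2 s \<in> par (Q\<^sub>2 (Suc s))" using sym_hole_par[OF H2, of s] m sm by auto
  ultimately show False using siblings_conn[OF p] same[of "Suc s"] m sm by auto
qed


lemma opposite_sides_apart:
  assumes H1: "sym_hole a\<^sub>1 j\<^sub>1 P\<^sub>1 Q\<^sub>1" and H2: "sym_hole a\<^sub>2 j\<^sub>2 P\<^sub>2 Q\<^sub>2"
    and l: "a\<^sub>1 < l" "a\<^sub>2 < l" "l \<le> l'" "l' < j\<^sub>1" "l' < j\<^sub>2"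
    and same: "\<And>t. l < t \<Longrightarrow> t \<le> j\<^sub>1 \<Longrightarrow> t \<le> j\<^sub>2 \<Longrightarrow> \<not> conn (P\<^sub>1 t) (P\<^sub>2 t)"
      "\<And>t. l' < t \<Longrightarrow> t \<le> j\<^sub>1 \<Longrightarrow> t \<le> j\<^sub>2 \<Longrightarrow> \<not> conn (Q\<^sub>1 t) (Q\<^sub>2 t)"
    and opp: "\<And>t. l \<le> t \<Longrightarrow> t \<le> j\<^sub>1 \<Longrightarrow> t \<le> j\<^sub>2 \<Longrightarrow> \<not> conn (P\<^sub>1 t) (Q\<^sub>2 t)"
    and ts: "l \<le> t" "t \<le> j\<^sub>1" "l' \<le> s" "s \<le> j\<^sub>2"
  shows "P\<^sub>1 t \<noteq> Q\<^sub>2 s \<and> \<not> P\<^sub>1 t \<sim> Q\<^sub>2 s"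
proof (rule ccontr)
  assume "\<not> ?thesis"
  then have near: "P\<^sub>1 t = Q\<^sub>2 s \<or> P\<^sub>1 t \<sim> Q\<^sub>2 s" by blast
  have lvs: "lv (P\<^sub>1 t) = t" "lv (Q\<^sub>2 s) = s"
    using sym_hole_lv[OF H1, of t] sym_hole_lv[OF H2, of s] l ts by auto
  then have "t = Suc s \<and> P\<^sub>1 t \<sim> Q\<^sub>2 s \<or> s = Suc t \<and> P\<^sub>1 t \<sim> Q\<^sub>2 s \<or> t = s"
    using near lv_step[of "P\<^sub>1 t" "Q\<^sub>2 s"] lv_step[OF adj_sym, of "P\<^sub>1 t" "Q\<^sub>2 s"] by auto
  moreover have "\<not> (t = Suc s \<and> P\<^sub>1 t \<sim> Q\<^sub>2 s)"
    using opposite_sides_apart_below[OF H1 H2 _ _ _ _ same(2) opp, of l' l s] l ts by auto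
  moreover have "\<not> Q\<^sub>2 (Suc t) \<sim> P\<^sub>1 t" if "Suc t \<le> j\<^sub>2"
  proof (rule opposite_sides_apart_below[OF sym_hole_swap[OF H2] sym_hole_swap[OF H1], of l l t])
    show "\<not> conn (P\<^sub>2 t) (P\<^sub>1 t)" if "l < t" "t \<le> j\<^sub>2" "t \<le> j\<^sub>1" for t
      using same(1)[OF that(1,3,2)] conn_sym by blast
    show "\<not> conn (Q\<^sub>2 t) (P\<^sub>1 t)" if "l \<le> t" "t \<le> j\<^sub>2" "t \<le> j\<^sub>1" for t
      using opp[OF that(1,3,2)] conn_sym by blast
  qed (use l ts that in simp_all)
  then have "\<not> (s = Suc t \<and> P\<^sub>1 t \<sim> Q\<^sub>2 s)" using ts adj_sym by blast
  ultimately have st: "t = s" by auto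
  then have "conn (P\<^sub>1 t) (Q\<^sub>2 t)" using near lvs conn_adj[of "P\<^sub>1 t" "Q\<^sub>2 t"] by auto
  then show False using opp[of t] st ts by auto
qed

lemma vpaths_apart:
  assumes H1: "sym_hole a\<^sub>1 j\<^sub>1 P\<^sub>1 Q\<^sub>1" and H2: "sym_hole a\<^sub>2 j\<^sub>2 P\<^sub>2 Q\<^sub>2"
    and l: "a\<^sub>1 < l" "a\<^sub>2 < l" "l \<le> l'" "l' < j\<^sub>1" "l' < j\<^sub>2"
    and same: "\<And>t. l < t \<Longrightarrow> t \<le> j\<^sub>1 \<Longrightarrow> t \<le> j\<^sub>2 \<Longrightarrow> \<not> conn (P\<^sub>1 t) (P\<^sub>2 t)"
      "\<And>t. l' < t \<Longrightarrow> t \<le> j\<^sub>1 \<Longrightarrow> t \<le> j\<^sub>2 \<Longrightarrow> \<not> conn (Q\<^sub>1 t) (Q\<^sub>2 t)"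
    and opp: "\<And>t. l \<le> t \<Longrightarrow> t \<le> j\<^sub>1 \<Longrightarrow> t \<le> j\<^sub>2 \<Longrightarrow> \<not> conn (P\<^sub>1 t) (Q\<^sub>2 t)"
      "\<And>t. l \<le> t \<Longrightarrow> t \<le> j\<^sub>1 \<Longrightarrow> t \<le> j\<^sub>2 \<Longrightarrow> \<not> conn (Q\<^sub>1 t) (P\<^sub>2 t)"
    and x: "x \<in> set (vpath P\<^sub>1 Q\<^sub>1 l l' j\<^sub>1)" and y: "y \<in> set (vpath P\<^sub>2 Q\<^sub>2 l l' j\<^sub>2)"
    and near: "x = y \<or> x \<sim> y"
  shows "x = P\<^sub>1 l \<and> y = P\<^sub>2 l \<or> x = Q\<^sub>1 l' \<and> y = Q\<^sub>2 l'"
proof -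
  consider (PP) t s where "x = P\<^sub>1 t" "l \<le> t" "t \<le> j\<^sub>1" "y = P\<^sub>2 s" "l \<le> s" "s \<le> j\<^sub>2"
    | (PQ) t s where "x = P\<^sub>1 t" "l \<le> t" "t \<le> j\<^sub>1" "y = Q\<^sub>2 s" "l' \<le> s" "s \<le> j\<^sub>2"
    | (QP) t s where "x = Q\<^sub>1 t" "l' \<le> t" "t \<le> j\<^sub>1" "y = P\<^sub>2 s" "l \<le> s" "s \<le> j\<^sub>2"
    | (QQ) t s where "x = Q\<^sub>1 t" "l' \<le> t" "t \<le> j\<^sub>1" "y = Q\<^sub>2 s" "l' \<le> s" "s \<le> j\<^sub>2"
  proof -
    have "(\<exists>t. x = P\<^sub>1 t \<and> l \<le> t \<and> t \<le> j\<^sub>1) \<or> (\<exists>t. x = Q\<^sub>1 t \<and> l' \<le> t \<and> t \<le> j\<^sub>1)"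
      using x l by (auto simp: set_vpath)
    moreover have "(\<exists>s. y = P\<^sub>2 s \<and> l \<le> s \<and> s \<le> j\<^sub>2) \<or> (\<exists>s. y = Q\<^sub>2 s \<and> l' \<le> s \<and> s \<le> j\<^sub>2)"
      using y l by (auto simp: set_vpath)
    ultimately show thesis using PP PQ QP QQ by blast
  qed
  then show ?thesis
  proof cases
    case PP
    then have "t = l \<and> s = l" using l near
      by (intro same_sides_apart[OF H1 H2 _ _ _ _ same(1) opp(2,1)]) auto
    then show ?thesis using PP by simp
  next
    case PQ
    then show ?thesis using opposite_sides_apart[OF H1 H2 l same opp(1), of t s] near by auto
  next
    case QP
    have "P\<^sub>2 s \<noteq> Q\<^sub>1 t \<and> \<not> P\<^sub>2 s \<sim> Q\<^sub>1 t"
    proof (rule opposite_sides_apart[OF H2 H1 l(2,1,3,5,4)])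
      show "\<not> conn (P\<^sub>2 t) (P\<^sub>1 t)" if "l < t" "t \<le> j\<^sub>2" "t \<le> j\<^sub>1" for t
        using same(1)[OF that(1,3,2)] conn_sym by blast
      show "\<not> conn (Q\<^sub>2 t) (Q\<^sub>1 t)" if "l' < t" "t \<le> j\<^sub>2" "t \<le> j\<^sub>1" for t
        using same(2)[OF that(1,3,2)] conn_sym by blast
      show "\<not> conn (P\<^sub>2 t) (Q\<^sub>1 t)" if "l \<le> t" "t \<le> j\<^sub>2" "t \<le> j\<^sub>1" for t
        using opp(2)[OF that(1,3,2)] conn_sym by blast
    qed (use QP in simp_all)
    then have "y \<noteq> x" "\<not> x \<sim> y" using QP(1,4) adj_sym by auto
    then show ?thesis using near by simp
  next
    case QQ
    then have "t = l' \<and> s = l'"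
      using l near opp by (intro same_sides_apart[OF sym_hole_swap[OF H1] sym_hole_swap[OF H2] _ _ _
        _ same(2)]) auto
    then show ?thesis using QQ by simp
  qed
qed

text \<open>If the sides met, this would be just above the bottom, and \<open>shared_adj\<close>
  would apply to both sides of the first hole. Then \<open>P\<^sub>2 l\<close> is the centre of a
  claw formed with \<open>P\<^sub>1 l\<close>, \<open>Q\<^sub>1 l\<close> and its own child
  \<open>P\<^sub>2 (Suc l)\<close>.\<close>

lemma shared_intermediate_sides:
  assumes H1: "sym_hole a\<^sub>1 j\<^sub>1 P\<^sub>1 Q\<^sub>1" and H2: "sym_hole a\<^sub>2 j\<^sub>2 P\<^sub>2 Q\<^sub>2"
    and l: "a\<^sub>1 < l" "l < j\<^sub>1" "a\<^sub>2 < l" "l < j\<^sub>2"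
    and c: "conn (P\<^sub>1 l) (P\<^sub>2 l)" and nc: "\<not> conn (P\<^sub>1 (Suc l)) (P\<^sub>2 (Suc l))"
  shows "\<not> conn (P\<^sub>1 l) (Q\<^sub>1 l)"
proof
  assume PQ: "conn (P\<^sub>1 l) (Q\<^sub>1 l)"
  then have j: "Suc l = j\<^sub>1" using sides_not_conn[OF H1 l(1)] l by (metis Suc_lessI)
  have c': "conn (Q\<^sub>1 l) (P\<^sub>2 l)" using PQ c conn_sym conn_trans by metis
  have nc': "\<not> conn (Q\<^sub>1 (Suc l)) (P\<^sub>2 (Suc l))" using nc sym_hole_bottom[OF H1] j by simp
  have adj: "P\<^sub>1 l \<sim> P\<^sub>2 l" "Q\<^sub>1 l \<sim> P\<^sub>2 l"
    using shared_adj[OF H1 H2 l c nc] shared_adj[OF sym_hole_swap[OF H1] H2 l c' nc'] by auto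
  have lvs: "lv (P\<^sub>1 l) = l" "lv (Q\<^sub>1 l) = l" "lv (P\<^sub>2 (Suc l)) = Suc l"
    using sym_hole_lv[OF H1, of l] sym_hole_lv[OF H2, of "Suc l"] l by auto
  have "\<not> P\<^sub>1 l \<sim> P\<^sub>2 (Suc l)"
    using siblings_conn[OF sym_hole_par(1)[OF H1, of l] parI] nc lvs l by auto
  moreover have "\<not> Q\<^sub>1 l \<sim> P\<^sub>2 (Suc l)"
    using siblings_conn[OF sym_hole_par(2)[OF H1, of l] parI] nc' lvs l by auto
  moreover have "P\<^sub>1 l \<noteq> P\<^sub>2 (Suc l)" "Q\<^sub>1 l \<noteq> P\<^sub>2 (Suc l)" using lvs by auto
  ultimately show False
    using no_claw[of "P\<^sub>2 l" "P\<^sub>1 l" "Q\<^sub>1 l" "P\<^sub>2 (Suc l)"] adj_sym[OF adj(1)] adj_sym[OF adj(2)]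
      sym_hole_adj(1)[OF H2, of l] sym_hole_neq[OF H1, of l] sym_hole_nadj[OF H1, of l] l by auto
qed

text \<open>Here \<open>l\<close> is the lowest shared level of the sides \<open>P\<^sub>1\<close> and \<open>P\<^sub>2\<close>. The parts of the two holes below it are
  joined by the edge between \<open>P\<^sub>1 l\<close> and \<open>P\<^sub>2 l\<close>. Either the result is a path with an even number of
  vertices that contradicts \<open>cap\<close>, or also \<open>Q\<^sub>1\<close> and \<open>Q\<^sub>2\<close> share a component, and cutting at their
  lowest shared level \<open>l'\<close> gives an even cycle.\<close>

lemma shared_intermediate_False:
  assumes H1: "sym_hole a\<^sub>1 j\<^sub>1 P\<^sub>1 Q\<^sub>1" and H2: "sym_hole a\<^sub>2 j\<^sub>2 P\<^sub>2 Q\<^sub>2"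
    and l: "a\<^sub>1 < l" "l < j\<^sub>1" "a\<^sub>2 < l" "l < j\<^sub>2"
    and c: "conn (P\<^sub>1 l) (P\<^sub>2 l)" and nc: "\<not> conn (P\<^sub>1 (Suc l)) (P\<^sub>2 (Suc l))"
    and nb: "\<not> conn (P\<^sub>1 j\<^sub>1) (P\<^sub>2 j\<^sub>2)"
  shows False
proof -
  note H1' = sym_hole_swap[OF H1] and H2' = sym_hole_swap[OF H2]
  have nb': "\<not> conn (P\<^sub>1 j\<^sub>1) (Q\<^sub>2 j\<^sub>2)" "\<not> conn (Q\<^sub>1 j\<^sub>1) (P\<^sub>2 j\<^sub>2)" "\<not> conn (Q\<^sub>1 j\<^sub>1) (Q\<^sub>2 j\<^sub>2)"
    using nb sym_hole_bottom[OF H1] sym_hole_bottom[OF H2] by simp_all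
  have nPQ1: "\<not> conn (P\<^sub>1 l) (Q\<^sub>1 l)" by (rule shared_intermediate_sides[OF H1 H2 l c nc])
  have nPQ2: "\<not> conn (P\<^sub>2 l) (Q\<^sub>2 l)"
    using shared_intermediate_sides[OF H2 H1 l(3,4,1,2) conn_sym[OF c]] nc conn_sym by blast
  have PP: "\<not> conn (P\<^sub>1 t) (P\<^sub>2 t)" if t: "l < t" "t \<le> j\<^sub>1" "t \<le> j\<^sub>2" for t
  proof
    assume ct: "conn (P\<^sub>1 t) (P\<^sub>2 t)"
    have "t < j\<^sub>1" using shared_above_bottom(1)[OF H1 H2 ct _ _ _ _ nb] t l by auto
    then show False using shared_ancestors[OF H1 H2 ct, of "Suc l"] t l nc by auto
  qed
  \<comment> \<open>A shared component of opposite sides would be inherited upward to level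
    \<open>l\<close>. There the shared component of \<open>P\<^sub>1\<close> and
    \<open>P\<^sub>2\<close> would connect both sides of one hole. The same reasoning gives
    \<open>QP\<close>.\<close>
  have PQ: "\<not> conn (P\<^sub>1 t) (Q\<^sub>2 t)" if t: "l \<le> t" "t \<le> j\<^sub>1" "t \<le> j\<^sub>2" for t
  proof
    assume ct: "conn (P\<^sub>1 t) (Q\<^sub>2 t)"
    have "t < j\<^sub>1" using shared_above_bottom(1)[OF H1 H2' ct _ _ _ _ nb'(1)] t l by auto
    then have "conn (P\<^sub>1 l) (Q\<^sub>2 l)" using shared_ancestors[OF H1 H2' ct, of l] t l by auto
    then show False using nPQ2 c conn_sym conn_trans by metis
  qed
  have QP: "\<not> conn (Q\<^sub>1 t) (P\<^sub>2 t)" if t: "l \<le> t" "t \<le> j\<^sub>1" "t \<le> j\<^sub>2" for t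
  proof
    assume ct: "conn (Q\<^sub>1 t) (P\<^sub>2 t)"
    have "t < j\<^sub>1" using shared_above_bottom(1)[OF H1' H2 ct _ _ _ _ nb'(2)] t l by auto
    then have "conn (Q\<^sub>1 l) (P\<^sub>2 l)" using shared_ancestors[OF H1' H2 ct, of l] t l by auto
    then show False using nPQ1 c conn_sym conn_trans by metis
  qed
  have adjP: "P\<^sub>1 l \<sim> P\<^sub>2 l" by (rule shared_adj[OF H1 H2 l c nc])
  then have neP: "P\<^sub>1 l \<noteq> P\<^sub>2 l" using adj_irrefl by metis
  show False
  proof (cases "conn (Q\<^sub>1 l) (Q\<^sub>2 l)")
    case True
    let ?S = "{t. l \<le> t \<and> t < j\<^sub>1 \<and> t < j\<^sub>2 \<and> conn (Q\<^sub>1 t) (Q\<^sub>2 t)}"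
    define l' where "l' = Max ?S"
    have S: "finite ?S" "l \<in> ?S" using True l by auto
    have "?S \<noteq> {}" using S(2) by blast
    then have "l' \<in> ?S" unfolding l'_def by (rule Max_in[OF S(1)])
    then have l': "l \<le> l'" "l' < j\<^sub>1" "l' < j\<^sub>2" "conn (Q\<^sub>1 l') (Q\<^sub>2 l')" by auto
    have QQ: "\<not> conn (Q\<^sub>1 t) (Q\<^sub>2 t)" if t: "l' < t" "t \<le> j\<^sub>1" "t \<le> j\<^sub>2" for t
    proof
      assume ct: "conn (Q\<^sub>1 t) (Q\<^sub>2 t)"
      have "t < j\<^sub>1" "t < j\<^sub>2" using shared_above_bottom[OF H1' H2' ct _ _ _ _ nb'(3)] t l l'
        by auto
      then have "t \<in> ?S" using ct t l' by auto
      from Max_ge[OF S(1) this] show False using t(1) unfolding l'_def by linarith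
    qed
    have adjQ: "Q\<^sub>1 l' \<sim> Q\<^sub>2 l'" using shared_adj[OF H1' H2' _ l'(2) _ l'(3,4)] QQ[of "Suc l'"] l l'
      by auto
    then have neQ: "Q\<^sub>1 l' \<noteq> Q\<^sub>2 l'" using adj_irrefl by metis
    let ?W1 = "vpath P\<^sub>1 Q\<^sub>1 l l' j\<^sub>1" and ?W2 = "vpath P\<^sub>2 Q\<^sub>2 l l' j\<^sub>2"
    have "induced_cycle A (?W1 @ rev ?W2)"
    proof (rule induced_cycle_append[OF sym_edges])
      show "induced_path A ?W1" using induced_path_vpath[OF H1] l l' by auto
      show "induced_path A (rev ?W2)" using induced_path_rev[OF induced_path_vpath[OF H2]] l l'
        by auto
      fix x y assume xy: "x \<in> set ?W1" "y \<in> set (rev ?W2)"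
      have "x = P\<^sub>1 l \<and> y = P\<^sub>2 l \<or> x = Q\<^sub>1 l' \<and> y = Q\<^sub>2 l'" if "x = y \<or> x \<sim> y"
        by (rule vpaths_apart[OF H1 H2 l(1,3) l'(1-3) PP QQ PQ QP _ _ that]) (use xy in auto)
      moreover have "hd (rev ?W2) = Q\<^sub>2 l'" "last (rev ?W2) = P\<^sub>2 l" "hd ?W1 = P\<^sub>1 l"
        "last ?W1 = Q\<^sub>1 l'"
        using l l' by (simp_all add: hd_rev last_rev hd_vpath last_vpath)
      ultimately show "x \<noteq> y \<and> (x \<sim> y \<longleftrightarrow> x = last ?W1 \<and> y = hd (rev ?W2) \<or> x = hd ?W1 \<and>
        y = last (rev ?W2))"
        using adjP adjQ neP neQ by metis
    qed (use l length_vpath_ge[of l j\<^sub>1 l' P\<^sub>1 Q\<^sub>1] l' in \<open>auto simp: vpath_ne\<close>)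
    moreover have "4 \<le> length (?W1 @ rev ?W2)"
      using l l' length_vpath_ge[of l j\<^sub>1 l' P\<^sub>1 Q\<^sub>1] length_vpath_ge[of l j\<^sub>2 l' P\<^sub>2 Q\<^sub>2]
      unfolding length_append length_rev by linarith
    \<comment> \<open>Both parts are cut at the same levels \<open>l\<close> and \<open>l'\<close>,
      so their lengths add up to twice \<open>j\<^sub>1 + j\<^sub>2 + 1 - l - l'\<close>.\<close>
    moreover have "even (length (?W1 @ rev ?W2))"
      using l l' by (simp add: length_vpath)
    ultimately show False using odd_cycle by blast
  next
    case False
    have QQ: "\<not> conn (Q\<^sub>1 t) (Q\<^sub>2 t)" if t: "l \<le> t" "t \<le> j\<^sub>1" "t \<le> j\<^sub>2" for t
    proof
      assume ct: "conn (Q\<^sub>1 t) (Q\<^sub>2 t)"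
      have "t < j\<^sub>1" using shared_above_bottom(1)[OF H1' H2' ct _ _ _ _ nb'(3)] t l by auto
      then show False using shared_ancestors[OF H1' H2' ct, of l] t l False by auto
    qed
    let ?W1 = "vpath P\<^sub>1 Q\<^sub>1 l l j\<^sub>1" and ?W2 = "vpath P\<^sub>2 Q\<^sub>2 l l j\<^sub>2"
    let ?W = "rev ?W1 @ ?W2"
    have ends: "hd (rev ?W1) = Q\<^sub>1 l" "last (rev ?W1) = P\<^sub>1 l" "hd ?W2 = P\<^sub>2 l" "last ?W2 = Q\<^sub>2 l"
      "?W1 \<noteq> []" "?W2 \<noteq> []"
      using l by (simp_all add: hd_rev last_rev hd_vpath last_vpath vpath_ne)
    then have ends': "hd ?W = Q\<^sub>1 l" "last ?W = Q\<^sub>2 l" by auto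
    have lvs: "lv (P\<^sub>1 l) = l" "lv (Q\<^sub>1 l) = l" "lv (P\<^sub>2 l) = l" "lv (Q\<^sub>2 l) = l"
      using sym_hole_lv[OF H1, of l] sym_hole_lv[OF H2, of l] l by auto
    have nQQ: "Q\<^sub>1 l \<noteq> Q\<^sub>2 l" "\<not> Q\<^sub>1 l \<sim> Q\<^sub>2 l" using False conn_adj lvs conn_refl by metis+
    have path: "induced_path A ?W"
    proof (rule induced_path_append[OF sym_edges])
      show "induced_path A (rev ?W1)" using induced_path_rev[OF induced_path_vpath[OF H1]] l by auto
      show "induced_path A ?W2" using induced_path_vpath[OF H2] l by auto
      fix x y assume xy: "x \<in> set (rev ?W1)" "y \<in> set ?W2"
      have "x = P\<^sub>1 l \<and> y = P\<^sub>2 l \<or> x = Q\<^sub>1 l \<and> y = Q\<^sub>2 l" if "x = y \<or> x \<sim> y"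
        by (rule vpaths_apart[OF H1 H2 l(1,3) order_refl l(2,4) PP QQ PQ QP _ _ that]) (use xy in
          auto)
      then show "x \<noteq> y \<and> (x \<sim> y \<longleftrightarrow> x = last (rev ?W1) \<and> y = hd ?W2)"
        unfolding ends using adjP neP nQQ by metis
    qed (use ends in auto)
    obtain p q where pq: "p \<in> par (Q\<^sub>1 l)" "q \<in> par (Q\<^sub>2 l)"
      using par_ne[of "Q\<^sub>1 l"] par_ne[of "Q\<^sub>2 l"] sym_hole_verts[OF H1, of l] sym_hole_verts[OF H2,
        of l] lvs l by auto
    have lvpq: "Suc (lv p) = l" "Suc (lv q) = l" using pq lvs by (auto simp: par_def)
    have mem: "\<exists>t. l \<le> t \<and> lv x = t \<and> (x = P\<^sub>1 t \<or> x = Q\<^sub>1 t \<or> x = P\<^sub>2 t \<or> x = Q\<^sub>2 t)"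
      if "x \<in> set ?W" for x
      using that l sym_hole_lv[OF H1] sym_hole_lv[OF H2] by (auto simp: set_vpath)
    have near: "x = P\<^sub>1 l \<or> x = Q\<^sub>1 l \<or> x = P\<^sub>2 l \<or> x = Q\<^sub>2 l"
      if "x \<in> set ?W" "u \<sim> x" "Suc (lv u) = l" for u x
      using mem[OF that(1)] lv_step[OF that(2)] that(3) by (metis le_antisym)
    have apart: "\<not> u \<sim> y" if "u \<in> par x" "\<not> conn x y" "lv x = l" "lv y = l" for u x y
      using siblings_conn[OF that(1) parI, of y] that by (auto simp: par_def)
    have "\<not> conn (Q\<^sub>1 l) (P\<^sub>1 l)" "\<not> conn (Q\<^sub>1 l) (P\<^sub>2 l)" "\<not> conn (Q\<^sub>1 l) (Q\<^sub>2 l)"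
      "\<not> conn (Q\<^sub>2 l) (P\<^sub>1 l)" "\<not> conn (Q\<^sub>2 l) (P\<^sub>2 l)" "\<not> conn (Q\<^sub>2 l) (Q\<^sub>1 l)"
      using nPQ1 nPQ2 False PQ[of l] QP[of l] l conn_sym by (meson less_imp_le_nat order_refl)+
    then have nbrs: "\<not> p \<sim> P\<^sub>1 l" "\<not> p \<sim> P\<^sub>2 l" "\<not> p \<sim> Q\<^sub>2 l" "\<not> q \<sim> P\<^sub>1 l" "\<not> q \<sim> P\<^sub>2 l"
      "\<not> q \<sim> Q\<^sub>1 l"
      using apart pq lvs by blast+
    have "odd (length ?W)"
    proof (rule cap[OF path, of l p q])
      show "\<forall>x \<in> set ?W. l \<le> lv x" using mem by blast
      show "\<forall>x \<in> set ?W. p \<sim> x \<longrightarrow> x = hd ?W" unfolding ends' using near lvpq nbrs by blast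
      show "\<forall>x \<in> set ?W. q \<sim> x \<longrightarrow> x = last ?W" unfolding ends' using near lvpq nbrs by blast
    qed (use ends' pq lvs l in \<open>simp_all add: length_vpath\<close>)
    \<comment> \<open>Each part is cut on one level and is therefore odd, so the joined path is
      even.\<close>
    then show False using odd_vpath[of l j\<^sub>1 P\<^sub>1 Q\<^sub>1] odd_vpath[of l j\<^sub>2 P\<^sub>2 Q\<^sub>2] l by simp
  qed
qed

lemma shared_imp_shared_bottom:
  assumes H1: "sym_hole a\<^sub>1 j\<^sub>1 P\<^sub>1 Q\<^sub>1" and H2: "sym_hole a\<^sub>2 j\<^sub>2 P\<^sub>2 Q\<^sub>2"
    and t: "conn (P\<^sub>1 t) (P\<^sub>2 t)" "a\<^sub>1 < t" "t \<le> j\<^sub>1" "a\<^sub>2 < t" "t \<le> j\<^sub>2"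
  shows "conn (P\<^sub>1 j\<^sub>1) (P\<^sub>2 j\<^sub>2)"
proof (rule ccontr)
  assume nb: "\<not> ?thesis"
  \<comment> \<open>The lowest shared level at or below \<open>t\<close> is the one where the holes
    part. It exists because, with unshared bottoms, \<open>t\<close> lies strictly above both of
    them.\<close>
  let ?S = "{s. t \<le> s \<and> s < j\<^sub>1 \<and> s < j\<^sub>2 \<and> conn (P\<^sub>1 s) (P\<^sub>2 s)}"
  have S: "finite ?S" "t \<in> ?S" using shared_above_bottom[OF H1 H2 t nb] t(1) by auto
  have "?S \<noteq> {}" using S(2) by blast
  then have "Max ?S \<in> ?S" by (rule Max_in[OF S(1)])
  then obtain l where l: "l = Max ?S" "t \<le> l" "l < j\<^sub>1" "l < j\<^sub>2" "conn (P\<^sub>1 l) (P\<^sub>2 l)" by blast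
  have "\<not> conn (P\<^sub>1 (Suc l)) (P\<^sub>2 (Suc l))"
  proof
    assume cl: "conn (P\<^sub>1 (Suc l)) (P\<^sub>2 (Suc l))"
    have "Suc l < j\<^sub>1" "Suc l < j\<^sub>2" using shared_above_bottom[OF H1 H2 cl _ _ _ _ nb] t l by auto
    then have "Suc l \<in> ?S" using cl l(2) by auto
    from Max_ge[OF S(1) this] show False using l(1) by linarith
  qed
  then show False using shared_intermediate_False[OF H1 H2 _ l(3) _ l(4,5)] nb t l by auto
qed

section \<open>Every hole is symmetric\<close>

lemma no_local_min:
  assumes C: "induced_cycle A vs" "4 \<le> length vs"
    and ijk: "i < length vs" "j < length vs" "k < length vs" "j \<noteq> k"
    and adj: "vs ! i \<sim> vs ! j" "vs ! i \<sim> vs ! k"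
  shows "\<not> (lv (vs ! j) = Suc (lv (vs ! i)) \<and> lv (vs ! k) = Suc (lv (vs ! i)))"
proof
  assume "lv (vs ! j) = Suc (lv (vs ! i)) \<and> lv (vs ! k) = Suc (lv (vs ! i))"
  then have "vs ! i \<in> par (vs ! j)" "vs ! i \<in> par (vs ! k)" using adj by (auto intro: parI)
  then have "vs ! j = vs ! k \<or> vs ! j \<sim> vs ! k" by (rule siblings)
  moreover have "vs ! j \<noteq> vs ! k" using C(1) ijk
    by (simp add: induced_cycle_def nth_eq_iff_index_eq)
  ultimately show False
    using adj ijk C(2) by (auto simp: induced_cycle_adj[OF C(1)])
qed

text \<open>The closing edge of the list is a horizontal edge of the largest level. The direction is
  chosen by comparing the parents of its ends; this choice makes the cycle descend at the head, see
  \<open>lv_second\<close>.\<close>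

definition lowest_horizontal :: "nat \<Rightarrow> 'a list \<Rightarrow> bool" where
  "lowest_horizontal a vs \<longleftrightarrow> induced_cycle A vs \<and> 4 \<le> length vs \<and>
     lv (hd vs) = a \<and> lv (last vs) = a \<and> par (hd vs) \<subseteq> par (last vs) \<and>
     (\<forall>u \<in> set vs. \<forall>v \<in> set vs. u \<sim> v \<longrightarrow> lv u = lv v \<longrightarrow> lv u \<le> a)"

lemma ex_lowest_horizontal:
  assumes C: "induced_cycle A vs" "4 \<le> length vs"
  obtains a ws where "lowest_horizontal a ws" "set ws = set vs"
proof -
  let ?n = "length vs"
  let ?E = "{(u, v). u \<in> set vs \<and> v \<in> set vs \<and> u \<sim> v \<and> lv u = lv v}"
  have fin: "finite ?E" by (rule finite_subset[of _ "set vs \<times> set vs"]) auto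
  \<comment> \<open>A vertex of least level on the cycle has no neighbour above it, and not both
    neighbours below it by \<open>no_local_min\<close>. So one of its cycle edges is
    horizontal.\<close>
  have "?E \<noteq> {}"
  proof -
    have "finite (lv ` set vs)" "lv ` set vs \<noteq> {}" using C by auto
    from Min_in[OF this] obtain x where x: "x \<in> set vs" "lv x = Min (lv ` set vs)" by auto
    then have least: "lv x \<le> lv y" if "y \<in> set vs" for y using that by simp
    obtain i where i: "i < ?n" "vs ! i = x" using x by (auto simp: in_set_conv_nth)
    define j where "j = (if Suc i = ?n then 0 else Suc i)"
    define k where "k = (if i = 0 then ?n - 1 else i - 1)"
    have jk: "j < ?n" "k < ?n" "j \<noteq> k" using i C by (auto simp: j_def k_def)
    have "j = Suc i \<or> j = 0 \<and> Suc i = ?n" "i = Suc k \<or> i = 0 \<and> Suc k = ?n"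
      using i C(2) by (auto simp: j_def k_def)
    then have adj: "vs ! i \<sim> vs ! j" "vs ! i \<sim> vs ! k"
      unfolding induced_cycle_adj[OF C(1) i(1) jk(1)] induced_cycle_adj[OF C(1) i(1) jk(2)] by auto
    have "\<not> (lv (vs ! j) = Suc (lv x) \<and> lv (vs ! k) = Suc (lv x))"
      using no_local_min[OF C i(1) jk adj] i by simp
    moreover have "lv x \<le> lv (vs ! j)" "lv x \<le> lv (vs ! k)"
      using least[OF nth_mem[OF jk(1)]] least[OF nth_mem[OF jk(2)]] by auto
    moreover have "lv (vs ! j) \<le> Suc (lv x)" "lv (vs ! k) \<le> Suc (lv x)"
      using lv_step[OF adj(1)] lv_step[OF adj(2)] i by auto
    ultimately have "lv (vs ! j) = lv x \<or> lv (vs ! k) = lv x" by linarith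
    then have "(x, vs ! j) \<in> ?E \<or> (x, vs ! k) \<in> ?E"
      using adj i(2) nth_mem[OF jk(1)] nth_mem[OF jk(2)] x(1) by auto
    then show ?thesis by blast
  qed
  define a where "a = Max ((\<lambda>(u, v). lv u) ` ?E)"
  have "a \<in> (\<lambda>(u, v). lv u) ` ?E" unfolding a_def using fin \<open>?E \<noteq> {}\<close> by (intro Max_in) auto
  then obtain u v where uv: "u \<in> set vs" "v \<in> set vs" "u \<sim> v" "lv u = a" "lv v = a" by auto
  have max: "lv u \<le> a" if "u \<in> set vs" "v \<in> set vs" "u \<sim> v" "lv u = lv v" for u v
    unfolding a_def using fin that by (intro Max_ge finite_imageI image_eqI[of _ _ "(u, v)"]) auto
  obtain i j where ij: "i < ?n" "j < ?n" "vs ! i = u" "vs ! j = v" using uv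
    by (auto simp: in_set_conv_nth)
  have "j = Suc i mod ?n \<or> i = Suc j mod ?n" using C(1) ij uv by (auto simp: induced_cycle_def)
  then obtain i where i: "i < ?n" "lv (vs ! i) = a" "lv (vs ! (Suc i mod ?n)) = a"
    "vs ! i \<sim> vs ! (Suc i mod ?n)"
    using ij uv adj_sym by metis
  define ws where "ws = rotate (Suc i) vs"
  have ws: "induced_cycle A ws" "length ws = ?n" "set ws = set vs"
    unfolding ws_def by (simp_all only: induced_cycle_rotate[OF C(1)] length_rotate set_rotate)
  have "ws \<noteq> []" using ws(2) C(2) by auto
  have "hd ws = vs ! (Suc i mod ?n)" unfolding ws_def by (rule hd_rotate_conv_nth) (use C in auto)
  moreover have "last ws = vs ! i"
  proof -
    have "last ws = vs ! ((Suc i + (?n - 1)) mod ?n)"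
      unfolding last_conv_nth[OF \<open>ws \<noteq> []\<close>] ws(2) unfolding ws_def using C(2)
        by (subst nth_rotate) auto
    moreover have "Suc i + (?n - 1) = i + ?n" using i(1) by simp
    ultimately show ?thesis using i(1) by simp
  qed
  ultimately have ends: "lv (hd ws) = a" "lv (last ws) = a" "hd ws \<sim> last ws" using i adj_sym
    by auto
  have rev: "induced_cycle A (rev ws)" "hd (rev ws) = last ws" "last (rev ws) = hd ws"
    using induced_cycle_rev[OF ws(1)] by (auto simp: hd_rev last_rev)
  consider "par (hd ws) \<subseteq> par (last ws)" | "par (last ws) \<subseteq> par (hd ws)"
    using par_comparable[OF ends(3)] ends by auto
  then show thesis
  proof cases
    case 1
    then show thesis using that[of a ws] ws ends max C(2) by (auto simp: lowest_horizontal_def)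
  next
    case 2
    then show thesis using that[of a "rev ws"] rev ws ends max C(2)
      by (auto simp: lowest_horizontal_def)
  qed
qed

lemma lowest_horizontal_rev:
  assumes "lowest_horizontal a vs" "par (last vs) \<subseteq> par (hd vs)"
  shows "lowest_horizontal a (rev vs)"
  using assms induced_cycle_rev[of A vs] by (auto simp: lowest_horizontal_def hd_rev last_rev)

lemma par_not_adj:
  assumes "p \<in> par x" "lv x < lv y \<or> lv x = lv y \<and> x \<noteq> y \<and> \<not> x \<sim> y"
  shows "\<not> p \<sim> y"
  using assms siblings[of p x y] lv_step[of p y] by (auto simp: par_def)

section \<open>Excursions of a cycle below its lowest horizontal edge\<close>

context
  fixes a vs n
  assumes L: "lowest_horizontal a vs" and n_def: "n = length vs"
begin

lemma hcycle: "induced_cycle A vs" "4 \<le> n"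
  using L by (auto simp: lowest_horizontal_def n_def)

lemma hcycle_adj: "i < n \<Longrightarrow> j < n \<Longrightarrow> vs ! i \<sim> vs ! j \<longleftrightarrow>
    j = Suc i \<or> i = Suc j \<or> i = 0 \<and> Suc j = n \<or> j = 0 \<and> Suc i = n"
  using induced_cycle_adj[OF hcycle(1)] by (simp add: n_def)

lemma hcycle_eq: "i < n \<Longrightarrow> j < n \<Longrightarrow> vs ! i = vs ! j \<longleftrightarrow> i = j"
  using hcycle(1) by (simp add: induced_cycle_def n_def nth_eq_iff_index_eq)

lemma hcycle_verts: "i < n \<Longrightarrow> vs ! i \<in> verts A"
  using hcycle(1) nth_mem[of i vs] by (auto simp: induced_cycle_def n_def)

lemma hcycle_odd: "odd n"
  using odd_cycle hcycle n_def by simp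

lemma hcycle_hd_last: "hd vs = vs ! 0" "last vs = vs ! (n - 1)"
proof -
  have "vs \<noteq> []" using hcycle n_def by auto
  then show "hd vs = vs ! 0" "last vs = vs ! (n - 1)"
    by (simp_all add: hd_conv_nth last_conv_nth n_def)
qed

lemma hcycle_lv_ends: "lv (vs ! 0) = a" "lv (vs ! (n - 1)) = a"
  using L hcycle_hd_last by (auto simp: lowest_horizontal_def)

lemma hcycle_par_ends: "par (vs ! 0) \<subseteq> par (vs ! (n - 1))"
  using L hcycle_hd_last by (auto simp: lowest_horizontal_def)

lemma hcycle_pos: "0 < a"
  using lv_le_1[of "vs ! 0" "vs ! (n - 1)"] hcycle_lv_ends hcycle_verts hcycle_eq[of 0 "n - 1"]
    hcycle(2) by (cases a) auto

lemma lv_vertical: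
  assumes "Suc i < n" "a < lv (vs ! i) \<or> a < lv (vs ! Suc i)"
  shows "lv (vs ! Suc i) = Suc (lv (vs ! i)) \<or> lv (vs ! i) = Suc (lv (vs ! Suc i))"
proof -
  have adj: "vs ! i \<sim> vs ! Suc i" using hcycle_adj assms by auto
  have "vs ! i \<in> set vs" "vs ! Suc i \<in> set vs" using assms n_def by auto
  then have "lv (vs ! i) \<noteq> lv (vs ! Suc i)"
    using L adj assms(2) unfolding lowest_horizontal_def by (metis not_le)
  then show ?thesis using lv_step[OF adj] lv_step[OF adj_sym[OF adj]] by auto
qed

text \<open>If \<open>vs ! 1\<close> lay in level \<open>a\<close>, a common parent with
  \<open>vs ! 0\<close> would also be a parent of the last vertex; if it lay higher, it would itself
  be such a parent. Either way it would be adjacent to the last vertex, which a cycle with four or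
  more vertices excludes.\<close>

lemma lv_second: "lv (vs ! 1) = Suc a"
proof -
  have adj: "vs ! 0 \<sim> vs ! 1" using hcycle_adj hcycle by auto
  have far: "\<not> vs ! 1 \<sim> vs ! (n - 1)" "vs ! (n - 1) \<noteq> vs ! 1"
    using hcycle_adj[of 1 "n - 1"] hcycle_eq[of "n - 1" 1] hcycle by auto
  have "lv (vs ! 1) \<noteq> a"
  proof
    assume "lv (vs ! 1) = a"
    then obtain p where "p \<in> par (vs ! 0)" "p \<in> par (vs ! 1)"
      using ex_common_parent[OF adj] hcycle_lv_ends by auto
    then show False using siblings[of p "vs ! (n - 1)" "vs ! 1"] hcycle_par_ends far adj_sym by auto
  qed
  moreover have "Suc (lv (vs ! 1)) \<noteq> a"
  proof
    assume "Suc (lv (vs ! 1)) = a"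
    then have "vs ! 1 \<in> par (vs ! 0)" using adj adj_sym hcycle_lv_ends by (auto intro: parI)
    then show False using hcycle_par_ends far parD(1) by auto
  qed
  ultimately show ?thesis using lv_step[OF adj] lv_step[OF adj_sym[OF adj]] hcycle_lv_ends by auto
qed

text \<open>Take the first return to level \<open>a\<close> or above; the last vertex guarantees
  one. Horizontal edges below level \<open>a\<close> do not occur, so the level changes by one in
  each step. This makes the length of the excursion even and lets it end exactly in level
  \<open>a\<close>.\<close>

lemma excursion:
  obtains s where "2 \<le> s" "s < n" "even s" "lv (vs ! s) = a" "\<And>i. 0 < i \<Longrightarrow> i < s \<Longrightarrow> a < lv (vs ! i)"
proof -
  define s where "s = (LEAST s. 0 < s \<and> lv (vs ! s) \<le> a)"
  have ex: "0 < n - 1 \<and> lv (vs ! (n - 1)) \<le> a" using hcycle hcycle_lv_ends by auto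
  have s: "0 < s" "lv (vs ! s) \<le> a" using LeastI[of "\<lambda>s. 0 < s \<and> lv (vs ! s) \<le> a", OF ex]
    unfolding s_def by auto
  have sn: "s < n" using Least_le[of "\<lambda>s. 0 < s \<and> lv (vs ! s) \<le> a", OF ex] hcycle(2) unfolding s_def
    by auto
  have above: "a < lv (vs ! i)" if "0 < i" "i < s" for i
    using not_less_Least[of i "\<lambda>s. 0 < s \<and> lv (vs ! s) \<le> a"] that unfolding s_def by auto
  have "s \<noteq> 1" using s lv_second by auto
  then have s2: "2 \<le> s" using s by auto
  have vert: "lv (vs ! Suc i) = Suc (lv (vs ! i)) \<or> lv (vs ! i) = Suc (lv (vs ! Suc i))" if "i < s"
    for i
    using lv_vertical[of i] above[of i] above[of "Suc i"] that sn lv_second by (cases i) auto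
  have "even (lv (vs ! i) + i + a)" if "i \<le> s" for i
    using that
  proof (induction i)
    case (Suc i)
    then show ?case using vert[of i] by auto
  qed (use hcycle_lv_ends in auto)
  moreover have "lv (vs ! s) = a"
    using vert[of "s - 1"] above[of "s - 1"] s s2 by auto
  ultimately have "even s" by force
  then show thesis using that s2 sn above \<open>lv (vs ! s) = a\<close> by blast
qed

lemma arc_cap:
  assumes sm: "Suc s < m" "m < n" and lvs: "lv (vs ! s) = a" "lv (vs ! m) = a"
    and between: "\<And>i. i \<le> s \<or> m \<le> i \<and> i < n \<Longrightarrow> a \<le> lv (vs ! i)"
    and p: "p \<in> par (vs ! m)" "\<And>i. i \<le> s \<or> m < i \<and> i < n \<Longrightarrow> \<not> p \<sim> vs ! i"
    and q: "q \<in> par (vs ! s)" "\<And>i. i < s \<or> m \<le> i \<and> i < n \<Longrightarrow> \<not> q \<sim> vs ! i"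
  shows "odd (n - m + Suc s)"
proof -
  let ?xs = "drop m vs @ take (Suc s) vs"
  have path: "induced_path A ?xs" using induced_cycle_arc[OF hcycle(1)] sm n_def by simp
  have ends: "hd ?xs = vs ! m" "last ?xs = vs ! s"
    using sm n_def by (auto simp: hd_append hd_drop_conv_nth take_Suc_conv_app_nth)
  have mem: "\<exists>i. (i \<le> s \<or> m \<le> i \<and> i < n) \<and> x = vs ! i" if "x \<in> set ?xs" for x
  proof -
    consider "x \<in> set (drop m vs)" | "x \<in> set (take (Suc s) vs)" using \<open>x \<in> set ?xs\<close> by auto
    then show ?thesis
    proof cases
      case 1
      then obtain i where "i < n - m" "x = vs ! (m + i)" using n_def sm
        by (auto simp: in_set_conv_nth)
      then show ?thesis by (intro exI[of _ "m + i"]) auto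
    next
      case 2
      then obtain i where "i < Suc s" "x = vs ! i" using n_def sm by (auto simp: in_set_conv_nth)
      then show ?thesis by (intro exI[of _ i]) auto
    qed
  qed
  have "odd (length ?xs)"
  proof (rule cap[OF path, of a p q])
    show "\<forall>x \<in> set ?xs. a \<le> lv x" using mem between by blast
    show "\<forall>x \<in> set ?xs. p \<sim> x \<longrightarrow> x = hd ?xs" unfolding ends using mem p(2)
      by (metis le_neq_implies_less)
    show "\<forall>x \<in> set ?xs. q \<sim> x \<longrightarrow> x = last ?xs" unfolding ends using mem q(2)
      by (metis le_neq_implies_less)
  qed (use ends lvs p q sm n_def in \<open>auto\<close>)
  then show ?thesis using sm n_def by simp
qed

text \<open>On an early return, the path from the last vertex across the closing edge to
  \<open>vs ! s\<close> has the even number \<open>s + 2\<close> of vertices. A parent of the last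
  vertex that is not one of the first would make \<open>cap\<close> applicable. As a consequence the
  reversed list also satisfies \<open>lowest_horizontal\<close>.\<close>

lemma excursion_par:
  assumes s: "2 \<le> s" "even s" "s < n - 1" "lv (vs ! s) = a"
    and above: "\<And>i. 0 < i \<Longrightarrow> i < s \<Longrightarrow> a < lv (vs ! i)"
  shows "par (vs ! (n - 1)) \<subseteq> par (vs ! 0)"
proof (rule ccontr)
  assume "\<not> ?thesis"
  then obtain p where p: "p \<in> par (vs ! (n - 1))" "p \<notin> par (vs ! 0)" by auto
  \<comment> \<open>Parity keeps the end of the excursion away from the last vertex:
    \<open>s\<close> is even and \<open>n\<close> is odd.\<close>
  have "Suc s \<noteq> n - 1"
  proof
    assume "Suc s = n - 1"
    then have "n = s + 2" using s(3) by linarith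
    then show False using hcycle_odd s(2) by simp
  qed
  then have sn: "Suc s < n - 1" using s(3) by linarith
  obtain q where q: "q \<in> par (vs ! s)" using par_ne[of "vs ! s"] hcycle_verts[of s] s hcycle_pos
    by auto
  have "odd (n - (n - 1) + Suc s)"
  proof (rule arc_cap[OF sn _ s(4) hcycle_lv_ends(2) _ p(1) _ q])
    show "a \<le> lv (vs ! i)" if "i \<le> s \<or> n - 1 \<le> i \<and> i < n" for i
    proof -
      have "i = 0 \<or> 0 < i \<and> i < s \<or> i = s \<or> i = n - 1" using that by linarith
      then show ?thesis using above[of i] hcycle_lv_ends s(4) by auto
    qed
    show "\<not> p \<sim> vs ! i" if i: "i \<le> s \<or> n - 1 < i \<and> i < n" for i
    proof (cases "i = 0")
      case True
      then show ?thesis using p hcycle_lv_ends by (auto simp: par_def)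
    next
      case False
      then have "i < n" "n - 1 < n" "n - 1 \<noteq> i" "i \<noteq> 0" "n - 1 \<noteq> Suc i" "i \<noteq> n" "n - 1 \<noteq> 0"
        "i \<noteq> Suc (n - 1)"
        using i sn by linarith+
      then have "vs ! (n - 1) \<noteq> vs ! i" "\<not> vs ! (n - 1) \<sim> vs ! i"
        using hcycle_eq[of "n - 1" i] hcycle_adj[of "n - 1" i] by simp_all
      moreover have "lv (vs ! i) = a \<or> a < lv (vs ! i)" using False i sn above[of i] s(4)
        by (cases "i = s") auto
      ultimately show ?thesis using par_not_adj[OF p(1), of "vs ! i"] hcycle_lv_ends by auto
    qed
    show "\<not> q \<sim> vs ! i" if i: "i < s \<or> n - 1 \<le> i \<and> i < n" for i
    proof (cases "i = 0 \<or> i = n - 1")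
      case True
      moreover have "s < n" "n - 1 < n" "0 < n" "s \<noteq> n - 1" "Suc s \<noteq> n" "Suc s \<noteq> n - 1" "n - 1 \<noteq> 0"
        "s \<noteq> n"
        using sn by linarith+
      ultimately have "vs ! s \<noteq> vs ! i" "\<not> vs ! s \<sim> vs ! i"
        using s(1) hcycle_eq[of s i] hcycle_adj[of s i] by auto
      moreover have "lv (vs ! i) = a" using True hcycle_lv_ends by auto
      ultimately show ?thesis using par_not_adj[OF q, of "vs ! i"] s(4) by auto
    next
      case False
      then have "a < lv (vs ! i)" using i above[of i] by auto
      then show ?thesis using par_not_adj[OF q, of "vs ! i"] s(4) by auto
    qed
  qed (use hcycle in auto)
  then show False using s(2) hcycle(2) by simp
qed

end

text \<open>If the cycle returned to level \<open>a\<close> before its end, then so it would in both directions, and the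
  two excursions together with the edge between the two ends form a path with an even number of
  vertices.\<close>

lemma lowest_horizontal_above:
  assumes L: "lowest_horizontal a vs" and n: "n = length vs" and i: "0 < i" "i < n - 1"
  shows "a < lv (vs ! i)"
proof -
  note hcycle = hcycle[OF L n] and hcycle_adj = hcycle_adj[OF L n] and hcycle_eq = hcycle_eq[OF L n]
    and hcycle_lv_ends = hcycle_lv_ends[OF L n] and hcycle_odd = hcycle_odd[OF L n]
  obtain s where s: "2 \<le> s" "s < n" "even s" "lv (vs ! s) = a"
    and above: "\<And>i. 0 < i \<Longrightarrow> i < s \<Longrightarrow> a < lv (vs ! i)"
    using excursion[OF L n] by blast
  have "s = n - 1"
  proof (rule ccontr)
    assume ne: "s \<noteq> n - 1"
    then have sn: "s < n - 1" using s by auto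
    have L': "lowest_horizontal a (rev vs)" and n': "n = length (rev vs)"
      using lowest_horizontal_rev[OF L] excursion_par[OF L n s(1,3) sn s(4) above]
      unfolding hcycle_hd_last[OF L n] using n by auto
    obtain s' where s': "2 \<le> s'" "s' < n" "even s'" "lv (rev vs ! s') = a"
      and above': "\<And>i. 0 < i \<Longrightarrow> i < s' \<Longrightarrow> a < lv (rev vs ! i)"
      using excursion[OF L' n'] by blast
    \<comment> \<open>\<open>vs ! m\<close> is \<open>rev vs ! s'\<close>, the vertex in which the
      excursion from the other end first returns to level \<open>a\<close>.\<close>
    define m where "m = n - 1 - s'"
    have m: "m + s' = n - 1" "m + 2 < n" using s'(1,2) by (auto simp: m_def)
    have lvm: "lv (vs ! m) = a" using s' n by (simp add: rev_nth m_def)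
    have above_m: "a < lv (vs ! i)" if "m < i" "i < n - 1" for i
    proof -
      have "a < lv (rev vs ! (n - 1 - i))" using above'[of "n - 1 - i"] that m by auto
      then show ?thesis using that n by (simp add: rev_nth)
    qed
    have "s \<le> m" using above_m[of s] s sn by (metis less_irrefl not_le)
    \<comment> \<open>Two excursions ending in the same vertex would make it a local minimum of the
      level on the cycle.\<close>
    moreover have "s \<noteq> m"
    proof
      assume sm: "s = m"
      have a1: "vs ! m \<sim> vs ! (m - 1)" "vs ! m \<sim> vs ! Suc m" using hcycle_adj[of m] m sm s by auto
      have "a < lv (vs ! (m - 1))" "a < lv (vs ! Suc m)"
        using above[of "m - 1"] above_m[of "Suc m"] m sm s s' by auto
      then have "lv (vs ! (m - 1)) = Suc (lv (vs ! m))" "lv (vs ! Suc m) = Suc (lv (vs ! m))"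
        using lv_step[OF a1(1)] lv_step[OF a1(2)] lvm by auto
      moreover have "m - 1 < n" "m - 1 \<noteq> Suc m" using m by linarith+
      ultimately show False using no_local_min[OF hcycle(1), of m "m - 1" "Suc m"] a1 hcycle(2) m n
        by auto
    qed
    moreover have "Suc s \<noteq> m"
    proof
      assume "Suc s = m"
      then have "n = s + s' + 2" using m by linarith
      then show False using hcycle_odd s(3) s'(3) by simp
    qed
    ultimately have sm: "Suc s < m" by linarith
    have mn: "m < n" using m by linarith
    obtain p q where pq: "p \<in> par (vs ! m)" "q \<in> par (vs ! s)"
      using par_ne[of "vs ! s"] par_ne[of "vs ! m"] hcycle_verts[OF L n, of s] hcycle_verts[OF L n,
        of m] mn s lvm hcycle_pos[OF L n] by auto
    have "odd (n - m + Suc s)"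
    proof (rule arc_cap[OF L n sm mn s(4) lvm _ pq(1) _ pq(2)])
      show "a \<le> lv (vs ! i)" if "i \<le> s \<or> m \<le> i \<and> i < n" for i
      proof -
        have "i = 0 \<or> 0 < i \<and> i < s \<or> i = s \<or> i = m \<or> m < i \<and> i < n - 1 \<or> i = n - 1" using that
          by linarith
        then show ?thesis using above[of i] above_m[of i] hcycle_lv_ends s(4) lvm by auto
      qed
      have far: "\<not> r \<sim> vs ! i"
        if x: "r \<in> par (vs ! x)" "lv (vs ! x) = a" "x < n" and i: "i \<le> s \<or> m \<le> i \<and> i < n"
          and far: "i \<in> {0, s, m, n - 1} \<Longrightarrow>
            x \<noteq> i \<and> i \<noteq> Suc x \<and> x \<noteq> Suc i \<and> x \<noteq> 0 \<and> Suc x \<noteq> n" for r x i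
      proof (cases "i \<in> {0, s, m, n - 1}")
        case True
        then have "i < n" "lv (vs ! i) = a" using hcycle_lv_ends s lvm mn by auto
        then show ?thesis using par_not_adj[OF x(1), of "vs ! i"] x far[OF True] hcycle_eq[of x i]
          hcycle_adj[of x i] by auto
      next
        case False
        then have "a < lv (vs ! i)" using i above[of i] above_m[of i] by auto
        then show ?thesis using par_not_adj[OF x(1), of "vs ! i"] x by auto
      qed
      show "\<not> p \<sim> vs ! i" if i: "i \<le> s \<or> m < i \<and> i < n" for i
      proof (rule far[OF pq(1) lvm mn])
        assume "i \<in> {0, s, m, n - 1}"
        then have "i = 0 \<or> i = s \<or> i = n - 1" using i sm by auto
        then show "m \<noteq> i \<and> i \<noteq> Suc m \<and> m \<noteq> Suc i \<and> m \<noteq> 0 \<and> Suc m \<noteq> n"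
          using sm m s(1) s'(1) by linarith
      qed (use i in auto)
      show "\<not> q \<sim> vs ! i" if i: "i < s \<or> m \<le> i \<and> i < n" for i
      proof (rule far[OF pq(2) s(4,2)])
        assume "i \<in> {0, s, m, n - 1}"
        then have "i = 0 \<or> i = m \<or> i = n - 1" using i sm by auto
        then show "s \<noteq> i \<and> i \<noteq> Suc s \<and> s \<noteq> Suc i \<and> s \<noteq> 0 \<and> Suc s \<noteq> n"
          using sm m s(1) s'(1) by linarith
      qed (use i in auto)
    qed
    moreover have "n - m = Suc s'" using m by linarith
    ultimately show False using s(3) s'(3) by simp
  qed
  then show ?thesis using above i by simp
qed

lemma induced_cycle_sym_hole:
  assumes "induced_cycle A xs" "4 \<le> length xs"
  obtains a j P Q where "sym_hole a j P Q" "set xs = P ` {a..j} \<union> Q ` {a..j}"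
proof -
  obtain a vs where L: "lowest_horizontal a vs" and set_vs: "set vs = set xs"
    using ex_lowest_horizontal[OF assms] by blast
  define n where "n = length vs"
  note hcycle = hcycle[OF L n_def] and hcycle_adj = hcycle_adj[OF L n_def]
    and hcycle_eq = hcycle_eq[OF L n_def]
    and hcycle_lv_ends = hcycle_lv_ends[OF L n_def] and hcycle_odd = hcycle_odd[OF L n_def]
    and above = lowest_horizontal_above[OF L n_def]
  \<comment> \<open>Length 4 is excluded by parity; this later gives \<open>2 \<le> k\<close> and
    thus the depth required by \<open>sym_hole\<close>.\<close>
  have n5: "5 \<le> n" using hcycle(2) hcycle_odd by (cases "n = 4") auto
  obtain k where k: "n - 1 = 2 * k" and up: "\<And>i. i \<le> k \<Longrightarrow> lv (vs ! i) = a + i"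
    and down: "\<And>i. i \<le> k \<Longrightarrow> lv (vs ! (n - 1 - i)) = a + i"
  proof (rule unimodal[of "\<lambda>i. lv (vs ! i)" a "n - 1"])
    show "lv (vs ! Suc i) = Suc (lv (vs ! i)) \<or> lv (vs ! i) = Suc (lv (vs ! Suc i))" if "i < n - 1"
      for i
      using lv_vertical[OF L n_def, of i] above[of i] above[of "Suc i"] that n5
        by (cases "i = 0") auto
    show "\<not> (lv (vs ! i) = Suc (lv (vs ! Suc i)) \<and> lv (vs ! Suc (Suc i)) = Suc (lv (vs ! Suc i)))"
      if "Suc i < n - 1" for i
      using no_local_min[OF hcycle(1), of "Suc i" i "Suc (Suc i)"] hcycle_adj[of "Suc i" i]
        hcycle_adj[of "Suc i" "Suc (Suc i)"] that n5 n_def by auto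
  qed (use hcycle_lv_ends n5 in auto)
  have k2: "2 \<le> k" and n: "n = Suc (2 * k)" using k n5 by auto
  \<comment> \<open>\<open>P\<close> and \<open>Q\<close> read the list from its two ends, and the
    shift by \<open>a\<close> turns positions into levels. They meet in \<open>vs ! k\<close>, the
    bottom vertex on level \<open>a + k\<close>.\<close>
  define P where "P l = vs ! (l - a)" for l
  define Q where "Q l = vs ! (2 * k - (l - a))" for l
  have PQ: "P (a + i) = vs ! i" "Q (a + i) = vs ! (2 * k - i)" for i by (simp_all add: P_def Q_def)
  have P_Suc: "P (Suc (a + i)) = vs ! Suc i" "Q (Suc (a + i)) = vs ! (2 * k - Suc i)" for i
    using PQ[of "Suc i"] by simp_all
  have ex: "\<exists>i. l = a + i \<and> i \<le> m" if "a \<le> l" "l \<le> a + m" for l m using that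
    by (metis add_le_cancel_left le_Suc_ex)
  have sym: "sym_hole a (a + k) P Q"
    unfolding sym_hole_def
  proof (intro conjI ballI)
    show "P (a + k) = Q (a + k)" by (simp add: PQ)
    show "P a \<sim> Q a" using hcycle_adj[of 0 "2 * k"] n by (simp add: P_def Q_def)
    fix l assume l: "l \<in> {a..a + k}"
    then obtain i where i: "l = a + i" "i \<le> k" using ex[of l k] by auto
    show "lv (P l) = l" "lv (Q l) = l" using up[OF i(2)] down[OF i(2), unfolded k] i
      by (simp_all add: PQ)
  next
    fix l assume l: "l \<in> {a..<a + k}"
    then obtain i where i: "l = a + i" "i < k" using ex[of l k] by auto
    show "P l \<sim> P (Suc l)" "Q l \<sim> Q (Suc l)"
      using hcycle_adj[of i "Suc i"] hcycle_adj[of "2 * k - i" "2 * k - Suc i"] i n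
        by (auto simp: PQ P_Suc)
  next
    fix l assume l: "l \<in> {a<..<a + k}"
    then obtain i where i: "l = a + i" "0 < i" "i < k" using ex[of l k] by auto
    show "P l \<noteq> Q l" "\<not> P l \<sim> Q l"
      using hcycle_eq[of i "2 * k - i"] hcycle_adj[of i "2 * k - i"] i n by (auto simp: PQ)
  qed (use k2 in auto)
  have "set vs = P ` {a..a + k} \<union> Q ` {a..a + k}"
  proof
    show "P ` {a..a + k} \<union> Q ` {a..a + k} \<subseteq> set vs"
      using n n_def by (auto simp: P_def Q_def intro!: nth_mem)
    show "set vs \<subseteq> P ` {a..a + k} \<union> Q ` {a..a + k}"
    proof
      fix x assume "x \<in> set vs"
      then obtain i where i: "i < n" "x = vs ! i" by (auto simp: in_set_conv_nth n_def)
      show "x \<in> P ` {a..a + k} \<union> Q ` {a..a + k}"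
      proof (cases "i \<le> k")
        case True
        then show ?thesis using PQ(1)[of i] i by (intro UnI1 image_eqI[of _ _ "a + i"]) auto
      next
        case False
        then show ?thesis using PQ(2)[of "2 * k - i"] i n
          by (intro UnI2 image_eqI[of _ _ "a + (2 * k - i)"]) auto
      qed
    qed
  qed
  then show thesis using that[OF sym] set_vs by simp
qed

section \<open>Components of holes\<close>

text \<open>Swapping the sides of each hole where necessary puts \<open>x\<close> and
  \<open>y\<close> on first sides. A swap does not change the bottom vertex, so the resulting
  statement about bottoms applies to the original sides.\<close>

lemma sym_holes_shared:
  assumes H1: "sym_hole a\<^sub>1 j\<^sub>1 P\<^sub>1 Q\<^sub>1" and H2: "sym_hole a\<^sub>2 j\<^sub>2 P\<^sub>2 Q\<^sub>2"
    and x: "x \<in> P\<^sub>1 ` {a\<^sub>1<..j\<^sub>1} \<union> Q\<^sub>1 ` {a\<^sub>1<..j\<^sub>1}"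
      and y: "y \<in> P\<^sub>2 ` {a\<^sub>2<..j\<^sub>2} \<union> Q\<^sub>2 ` {a\<^sub>2<..j\<^sub>2}"
    and c: "conn x y"
  shows "a\<^sub>1 = a\<^sub>2 \<and> j\<^sub>1 = j\<^sub>2 \<and>
    (same_shape a\<^sub>1 j\<^sub>1 P\<^sub>1 Q\<^sub>1 P\<^sub>2 Q\<^sub>2 \<or> same_shape a\<^sub>1 j\<^sub>1 P\<^sub>1 Q\<^sub>1 Q\<^sub>2 P\<^sub>2)"
proof -
  have side: "\<exists>P' Q' t. sym_hole a j P' Q' \<and> z = P' t \<and> a < t \<and> t \<le> j \<and> P' j = P j"
    if "sym_hole a j P Q" "z \<in> P ` {a<..j} \<union> Q ` {a<..j}" for a j P Q z
  proof -
    have "\<exists>P' Q'. sym_hole a j P' Q' \<and> z \<in> P' ` {a<..j} \<and> P' j = P j"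
      using that sym_hole_swap[OF that(1)] sym_hole_bottom[OF that(1)] by (metis Un_iff)
    then obtain P' Q' t where "sym_hole a j P' Q'" "P' j = P j" "z = P' t" "a < t" "t \<le> j" by auto
    then show ?thesis by blast
  qed
  obtain P\<^sub>1' Q\<^sub>1' t where 1: "sym_hole a\<^sub>1 j\<^sub>1 P\<^sub>1' Q\<^sub>1'" "x = P\<^sub>1' t" "a\<^sub>1 < t" "t \<le> j\<^sub>1"
    "P\<^sub>1' j\<^sub>1 = P\<^sub>1 j\<^sub>1"
    using side[OF H1 x] by blast
  obtain P\<^sub>2' Q\<^sub>2' u where 2: "sym_hole a\<^sub>2 j\<^sub>2 P\<^sub>2' Q\<^sub>2'" "y = P\<^sub>2' u" "a\<^sub>2 < u" "u \<le> j\<^sub>2"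
    "P\<^sub>2' j\<^sub>2 = P\<^sub>2 j\<^sub>2"
    using side[OF H2 y] by blast
  have "t = u" using conn_lv[OF c] sym_hole_lv(1)[OF 1(1), of t] sym_hole_lv(1)[OF 2(1), of u] 1 2
    by auto
  then have "conn (P\<^sub>1 j\<^sub>1) (P\<^sub>2 j\<^sub>2)"
    using shared_imp_shared_bottom[OF 1(1) 2(1), of t] c 1 2 by auto
  then show ?thesis by (rule shared_bottom[OF H1 H2])
qed

definition level_comp :: "'a \<Rightarrow> 'a set" where
  "level_comp x = {y. conn x y}"

lemma level_comp_eq: "level_comp x = level_comp y \<longleftrightarrow> conn x y"
  unfolding level_comp_def using conn_refl conn_sym conn_trans by blast

end

section \<open>Distance levels and the sets \<open>tau\<close> in terms of symmetric holes\<close>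

locale rooted_graph = levelled_graph A "\<lambda>x. distance A x r" for A :: "'a sgraph" and r :: 'a
begin

abbreviation lv :: "'a \<Rightarrow> nat" where
  "lv x \<equiv> distance A x r"

lemma component_of_level:
  assumes "v \<in> level A r l"
  shows "component_of (induced A (level A r l)) v = level_comp v"
proof -
  let ?L = "level A r l"
  let ?E = "edges (induced A ?L)"
  have E: "(x, y) \<in> ?E \<longleftrightarrow> (x, y) \<in> edges A \<and> lv x = l \<and> lv y = l" for x y
    by (auto simp: induced_def level_def dest: adj_verts)
  have sound: "conn v w" if "(v, w) \<in> ?E\<^sup>*" for w
    using that
  proof (induction rule: rtrancl_induct)
    case (step y z)
    then show ?case using E conn_adj[of y z] conn_trans by auto
  qed simp
  have complete: "(v, w) \<in> ?E\<^sup>* \<and> lv w = l" if "conn v w" for w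
    using that unfolding conn_def
  proof (induction rule: rtrancl_induct)
    case base
    then show ?case using assms by (simp add: level_def)
  next
    case (step y z)
    then have "(y, z) \<in> ?E" "lv z = l" unfolding E by auto
    then show ?case using step.IH by (meson rtrancl.rtrancl_into_rtrancl)
  qed
  have v: "v \<in> verts A" using assms by (simp add: level_def)
  show ?thesis
  proof (intro set_eqI iffI)
    fix w assume "w \<in> component_of (induced A ?L) v"
    then have "(v, w) \<in> ?E\<^sup>*" by (simp add: component_of_def)
    then show "w \<in> level_comp v" unfolding level_comp_def using sound by blast
  next
    fix w assume "w \<in> level_comp v"
    then have "conn v w" by (simp add: level_comp_def)
    then show "w \<in> component_of (induced A ?L) v"
      using complete[of w] conn_verts[of v w] v
      unfolding component_of_def by (simp add: induced_def level_def)
  qed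
qed

lemma level_components_eq: "level_components A r l = level_comp ` level A r l"
proof -
  have "verts (induced A (level A r l)) = level A r l" by (auto simp: induced_def level_def)
  then show ?thesis unfolding level_components_def components_def
    by (simp add: component_of_level cong: image_cong_simp)
qed

lemma hole_components_eq:
  fixes H :: "'a sgraph"
  assumes "verts H \<subseteq> verts A"
  shows "hole_components A r H l = level_comp ` (level A r l \<inter> verts H)"
proof
  show "hole_components A r H l \<subseteq> level_comp ` (level A r l \<inter> verts H)"
  proof
    fix C assume "C \<in> hole_components A r H l"
    then obtain v w where vw: "v \<in> level A r l" "C = level_comp v" "w \<in> C" "w \<in> verts H"
      by (auto simp: hole_components_def level_components_eq)
    then have "conn v w" by (simp add: level_comp_def)
    then have "w \<in> level A r l" "C = level_comp w"
      using conn_lv conn_verts level_comp_eq vw(1,2) by (fastforce simp: level_def)+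
    then show "C \<in> level_comp ` (level A r l \<inter> verts H)" using vw(4) by blast
  qed
  show "level_comp ` (level A r l \<inter> verts H) \<subseteq> hole_components A r H l"
  proof
    fix C assume "C \<in> level_comp ` (level A r l \<inter> verts H)"
    then obtain x where "C = level_comp x" "x \<in> level A r l" "x \<in> verts H" by blast
    moreover have "x \<in> level_comp x" by (simp add: level_comp_def)
    ultimately show "C \<in> hole_components A r H l"
      unfolding hole_components_def level_components_eq by blast
  qed
qed

context
  fixes a j :: nat and P Q :: "nat \<Rightarrow> 'a" and H :: "'a sgraph"
  assumes S: "sym_hole a j P Q" and VH: "verts H = P ` {a..j} \<union> Q ` {a..j}"
begin

lemma verts_H: "verts H \<subseteq> verts A"
  using sym_hole_verts[OF S] VH by auto

lemma levels_H: "level A r l \<inter> verts H = (if l \<in> {a..j} then {P l, Q l} else {})"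
proof -
  have "P i \<in> level A r l \<longleftrightarrow> i = l" "Q i \<in> level A r l \<longleftrightarrow> i = l" if "a \<le> i" "i \<le> j" for i
    using sym_hole_lv[OF S that] sym_hole_verts[OF S that] by (simp_all add: level_def)
  then show ?thesis unfolding VH by auto
qed

lemma indices_H: "first_index A r H = a" "last_index A r H = j"
proof -
  have "{i. level A r i \<inter> verts H \<noteq> {}} = {a..j}" unfolding levels_H by auto
  then show "first_index A r H = a" "last_index A r H = j"
    using sym_hole_bounds[OF S] unfolding first_index_def last_index_def
    by (auto intro!: Min_eqI Max_eqI)
qed

lemma tau_H: "tau A r H = level_comp ` (P ` {a<..j} \<union> Q ` {a<..j})"
proof -
  have "{a + 1..j} = {a<..j}" by auto
  then have "tau A r H = (\<Union>l \<in> {a<..j}. level_comp ` {P l, Q l})"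
    unfolding tau_def indices_H hole_components_eq[OF verts_H] levels_H by auto
  then show ?thesis unfolding image_Un image_image by auto
qed

lemma is_first_component_H: "is_first_component A r H (level_comp (P a))"
proof -
  have a: "a \<le> j" using sym_hole_bounds[OF S] by simp
  have "lv (P a) = lv (Q a)" using sym_hole_lv[OF S order_refl a] by simp
  then have "conn (P a) (Q a)" by (rule conn_adj[OF sym_hole_top[OF S]])
  then have "Q a \<in> level_comp (P a)" "P a \<in> level_comp (P a)" by (simp_all add: level_comp_def)
  moreover have HL: "verts H \<inter> level A r a = {P a, Q a}" using levels_H[of a] a
    by (simp add: Int_commute)
  moreover have "P a \<in> level A r a" using HL by blast
  ultimately show ?thesis
    unfolding is_first_component_def indices_H level_components_eq by simp
qed

end

lemma tau_dichotomy:
  fixes H\<^sub>1 H\<^sub>2 :: "'a sgraph"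
  assumes S1: "sym_hole a\<^sub>1 j\<^sub>1 P\<^sub>1 Q\<^sub>1" and V1: "verts H\<^sub>1 = P\<^sub>1 ` {a\<^sub>1..j\<^sub>1} \<union> Q\<^sub>1 ` {a\<^sub>1..j\<^sub>1}"
    and S2: "sym_hole a\<^sub>2 j\<^sub>2 P\<^sub>2 Q\<^sub>2" and V2: "verts H\<^sub>2 = P\<^sub>2 ` {a\<^sub>2..j\<^sub>2} \<union> Q\<^sub>2 ` {a\<^sub>2..j\<^sub>2}"
    and meet: "tau A r H\<^sub>1 \<inter> tau A r H\<^sub>2 \<noteq> {}"
  shows "tau A r H\<^sub>1 = tau A r H\<^sub>2 \<and> (\<exists>C. is_first_component A r H\<^sub>1 C \<and>
    is_first_component A r H\<^sub>2 C)"
proof -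
  note tau = tau_H[OF S1 V1] tau_H[OF S2 V2]
  obtain x y where xy: "x \<in> P\<^sub>1 ` {a\<^sub>1<..j\<^sub>1} \<union> Q\<^sub>1 ` {a\<^sub>1<..j\<^sub>1}" "y \<in> P\<^sub>2 ` {a\<^sub>2<..j\<^sub>2} \<union>
    Q\<^sub>2 ` {a\<^sub>2<..j\<^sub>2}" "level_comp x = level_comp y"
    using meet unfolding tau by blast
  \<comment> \<open>The sides are kept arbitrary because \<open>same_shape\<close> may hold only
    after swapping those of the second hole.\<close>
  have key: "tau A r H\<^sub>1 = tau A r H\<^sub>2 \<and> is_first_component A r H\<^sub>2 (level_comp (P\<^sub>1 a\<^sub>1))"
    if S2: "sym_hole a\<^sub>1 j\<^sub>1 P Q" and V2: "verts H\<^sub>2 = P ` {a\<^sub>1..j\<^sub>1} \<union> Q ` {a\<^sub>1..j\<^sub>1}"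
      and same: "same_shape a\<^sub>1 j\<^sub>1 P\<^sub>1 Q\<^sub>1 P Q" for P Q
  proof -
    have eq: "level_comp (P\<^sub>1 l) = level_comp (P l)" "level_comp (Q\<^sub>1 l) = level_comp (Q l)"
      if "a\<^sub>1 \<le> l" "l \<le> j\<^sub>1" for l
      using same that by (auto simp: same_shape_def level_comp_eq)
    have "tau A r H\<^sub>1 = tau A r H\<^sub>2"
      unfolding tau(1) tau_H[OF S2 V2] image_Un image_image using eq
        by (intro arg_cong2[of _ _ _ _ "(\<union>)"] image_cong) auto
    then show ?thesis using is_first_component_H[OF S2 V2] eq(1)[of a\<^sub>1] sym_hole_bounds[OF S1]
      by simp
  qed
  have "a\<^sub>1 = a\<^sub>2 \<and> j\<^sub>1 = j\<^sub>2 \<and>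
    (same_shape a\<^sub>1 j\<^sub>1 P\<^sub>1 Q\<^sub>1 P\<^sub>2 Q\<^sub>2 \<or> same_shape a\<^sub>1 j\<^sub>1 P\<^sub>1 Q\<^sub>1 Q\<^sub>2 P\<^sub>2)"
    using sym_holes_shared[OF S1 S2 xy(1,2)] xy(3) level_comp_eq by blast
  then have "tau A r H\<^sub>1 = tau A r H\<^sub>2 \<and> is_first_component A r H\<^sub>2 (level_comp (P\<^sub>1 a\<^sub>1))"
    using key[of P\<^sub>2 Q\<^sub>2] key[of Q\<^sub>2 P\<^sub>2] S2 sym_hole_swap[OF S2] V2 by (auto simp: Un_commute)
  then show ?thesis using is_first_component_H[OF S1 V1] by blast
qed

end

section \<open>The level structure of the given graph\<close>

lemma induced_induced: "induced (induced G S) T = induced G (S \<inter> T)"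
  by (auto simp: induced_def)

lemma simple_graph_induced: "simple_graph G \<Longrightarrow> simple_graph (induced G S)"
  by (auto simp: simple_graph_def induced_def sym_def irrefl_def)

lemma claw_free_induced:
  assumes "claw_free G"
  shows "claw_free (induced G S)"
  unfolding claw_free_def
proof clarify
  fix T assume "T \<subseteq> verts (induced G S)" "claw (induced (induced G S) T)"
  then have "S \<inter> T \<subseteq> verts G" "claw (induced G (S \<inter> T))"
    unfolding induced_induced by (auto simp: induced_def)
  then show False using assms by (auto simp: claw_free_def)
qed

lemma hole_obtain_cycle:
  assumes "hole G H"
  obtains vs where "induced_cycle G vs" "set vs = verts H" "4 \<le> length vs"
proof -
  obtain vs where vs: "distinct vs" "verts H = set vs"
    and E: "edges H = {(vs ! i, vs ! j) | i j. i < length vs \<and> j < length vs \<and>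
              (j = Suc i mod length vs \<or> i = Suc j mod length vs)}"
    using assms by (auto simp: hole_def cycle_graph_def)
  have H: "verts H \<subseteq> verts G" "edges H = edges G \<inter> verts H \<times> verts H"
    using assms unfolding hole_def induced_def
      by (metis Int_lower1 sgraph.select_convs(1), metis sgraph.select_convs(2))
  have "(vs ! i, vs ! j) \<in> edges G \<longleftrightarrow> j = Suc i mod length vs \<or> i = Suc j mod length vs"
    if "i < length vs" "j < length vs" for i j
  proof -
    have "(vs ! i, vs ! j) \<in> edges G \<longleftrightarrow> (vs ! i, vs ! j) \<in> edges H" using H(2) vs(2) that by auto
    also have "\<dots> \<longleftrightarrow> j = Suc i mod length vs \<or> i = Suc j mod length vs"
      unfolding E using that vs(1) by (auto simp: nth_eq_iff_index_eq)
    finally show ?thesis .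
  qed
  then have "induced_cycle G vs" using vs H by (simp add: induced_cycle_def)
  moreover have "4 \<le> length vs" using assms vs distinct_card[OF vs(1)] by (simp add: hole_def)
  ultimately show thesis using that vs by simp
qed

lemma odd_induced_cycle:
  assumes "even_hole_free G" "induced_cycle G vs" "4 \<le> length vs"
  shows "odd (length vs)"
proof
  assume "even (length vs)"
  let ?H = "induced G (set vs)"
  have V: "verts ?H = set vs" "distinct vs" using assms(2)
    by (auto simp: induced_def induced_cycle_def)
  have card: "card (set vs) = length vs" by (rule distinct_card[OF V(2)])
  have "edges ?H = {(vs ! i, vs ! j) | i j. i < length vs \<and> j < length vs \<and>
              (j = Suc i mod length vs \<or> i = Suc j mod length vs)}" (is "_ = ?R")
  proof
    show "edges ?H \<subseteq> ?R"
    proof clarify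
      fix x y assume "(x, y) \<in> edges ?H"
      then have "(x, y) \<in> edges G" "x \<in> set vs" "y \<in> set vs" by (auto simp: induced_def)
      then obtain i j where "i < length vs" "j < length vs" "x = vs ! i" "y = vs ! j"
        "(vs ! i, vs ! j) \<in> edges G"
        by (auto simp: in_set_conv_nth)
      then show "\<exists>i j. (x, y) = (vs ! i, vs ! j) \<and> i < length vs \<and> j < length vs \<and>
          (j = Suc i mod length vs \<or> i = Suc j mod length vs)"
        using assms(2) unfolding induced_cycle_def by blast
    qed
    show "?R \<subseteq> edges ?H"
    proof
      fix e assume "e \<in> ?R"
      then obtain i j where "i < length vs" "j < length vs" "e = (vs ! i, vs ! j)"
        "j = Suc i mod length vs \<or> i = Suc j mod length vs" by blast
      moreover from this have "(vs ! i, vs ! j) \<in> edges G" using assms(2)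
        unfolding induced_cycle_def by blast
      ultimately show "e \<in> edges ?H" by (simp add: induced_def)
    qed
  qed
  then have "cycle_graph ?H" unfolding cycle_graph_def using V assms(3) by (intro exI[of _ vs]) auto
  moreover have "?H = induced G (verts ?H)" by (simp add: V)
  ultimately have "even_hole G ?H" using V card assms(3) \<open>even (length vs)\<close>
    by (simp add: even_hole_def hole_def)
  then show False using assms(1) by (auto simp: even_hole_free_def)
qed

lemma induced_cycle_induced:
  assumes "induced_cycle (induced G S) vs"
  shows "induced_cycle G vs"
proof -
  have "set vs \<subseteq> S" "set vs \<subseteq> verts G" using assms by (auto simp: induced_cycle_def induced_def)
  then have "(vs ! i, vs ! j) \<in> edges G \<longleftrightarrow> (vs ! i, vs ! j) \<in> edges (induced G S)"
    if "i < length vs" "j < length vs" for i j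
    using that nth_mem[of i vs] nth_mem[of j vs] by (auto simp: induced_def)
  then show ?thesis using assms \<open>set vs \<subseteq> verts G\<close> by (simp add: induced_cycle_def)
qed

lemma component_connected:
  assumes sym: "sym (edges G)" and E: "edges G \<subseteq> verts G \<times> verts G"
    and x: "x \<in> component_of G r"
  shows "(x, r) \<in> (edges (induced G (component_of G r)))\<^sup>*"
proof -
  let ?C = "component_of G r"
  have "(r, x) \<in> (edges G)\<^sup>*" using x by (simp add: component_of_def)
  then show ?thesis
  proof (induction rule: rtrancl_induct)
    case (step y z)
    have "y \<in> ?C" "z \<in> ?C" using step.hyps E by (auto simp: component_of_def)
    then have "(z, y) \<in> edges (induced G ?C)" using step.hyps(2) sym
      by (auto simp: induced_def dest: symD)
    then show ?case using step.IH by (rule converse_rtrancl_into_rtrancl)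
  qed simp
qed

section \<open>Distances to the root\<close>

context
  fixes A :: "'a sgraph" and r :: 'a
  assumes conn: "\<And>x. x \<in> verts A \<Longrightarrow> (x, r) \<in> (edges A)\<^sup>*" and A: "simple_graph A"
begin

lemma relpow_distance: "x \<in> verts A \<Longrightarrow> (x, r) \<in> edges A ^^ distance A x r"
  unfolding distance_def using conn[of x] by (metis LeastI rtrancl_imp_relpow)

lemma distance_le: "(x, r) \<in> edges A ^^ n \<Longrightarrow> distance A x r \<le> n"
  unfolding distance_def by (rule Least_le)

lemma distance_step:
  assumes "(x, y) \<in> edges A"
  shows "distance A y r \<le> Suc (distance A x r)"
proof -
  have "x \<in> verts A" "(y, x) \<in> edges A" using A assms by (auto simp: simple_graph_def dest: symD)
  then have "(y, r) \<in> edges A ^^ Suc (distance A x r)" using relpow_distance relpow_Suc_I2 by metis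
  then show ?thesis by (rule distance_le)
qed

lemma distance_parent:
  assumes "x \<in> verts A" "distance A x r = Suc k"
  shows "\<exists>p. (p, x) \<in> edges A \<and> distance A p r = k"
proof -
  have "(x, r) \<in> edges A ^^ Suc k" using relpow_distance[OF assms(1)] assms(2) by simp
  then obtain p where p: "(x, p) \<in> edges A" "(p, r) \<in> edges A ^^ k" by (meson relpow_Suc_D2)
  have px: "(p, x) \<in> edges A" using p A by (auto simp: simple_graph_def dest: symD)
  then show ?thesis using distance_step[OF px] distance_le[OF p(2)] assms(2)
    by (intro exI[of _ p]) auto
qed

end

theorem theorem3p5:
  fixes G G\<^sub>0 H\<^sub>1 H\<^sub>2 :: "'a sgraph" and u\<^sub>0 u\<^sub>1 :: 'a and B\<^sub>0 :: "'a set"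
  assumes "simple_graph G" and "claw_free G" and "even_hole_free G"
    and "(u\<^sub>0, u\<^sub>1) \<in> edges G"
    and "B\<^sub>0 = neighbours G u\<^sub>0 - {u\<^sub>1}"
    and "G\<^sub>0 = induced (delete G B\<^sub>0) (component_of (delete G B\<^sub>0) u\<^sub>0)"
    and "hole G\<^sub>0 H\<^sub>1" and "hole G\<^sub>0 H\<^sub>2"
  shows "(tau G\<^sub>0 u\<^sub>0 H\<^sub>1 \<inter> tau G\<^sub>0 u\<^sub>0 H\<^sub>2 = {} \<or> tau G\<^sub>0 u\<^sub>0 H\<^sub>1 = tau G\<^sub>0 u\<^sub>0 H\<^sub>2) \<and>
    (tau G\<^sub>0 u\<^sub>0 H\<^sub>1 = tau G\<^sub>0 u\<^sub>0 H\<^sub>2 \<longrightarrow>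
      (\<exists>C. is_first_component G\<^sub>0 u\<^sub>0 H\<^sub>1 C \<and> is_first_component G\<^sub>0 u\<^sub>0 H\<^sub>2 C))"
proof -
  let ?D = "delete G B\<^sub>0" and ?lv = "\<lambda>x. distance G\<^sub>0 x u\<^sub>0"
  have D: "simple_graph ?D" unfolding delete_def by (rule simple_graph_induced[OF assms(1)])
  have "\<exists>S. G\<^sub>0 = induced G S" unfolding assms(6) delete_def induced_induced by blast
  then obtain S where S: "G\<^sub>0 = induced G S" by blast
  have simple: "simple_graph G\<^sub>0" unfolding S by (rule simple_graph_induced[OF assms(1)])
  have conn: "(x, u\<^sub>0) \<in> (edges G\<^sub>0)\<^sup>*" if "x \<in> verts G\<^sub>0" for x
    unfolding assms(6)
    by (rule component_connected) (use D that assms(6) in \<open>auto simp: simple_graph_def induced_def\<close>)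
  \<comment> \<open>All neighbours of the root other than \<open>u\<^sub>1\<close> were deleted with
    \<open>B\<^sub>0\<close>. Hence levels 0 and 1 can contain only \<open>u\<^sub>0\<close> and
    \<open>u\<^sub>1\<close>.\<close>
  have root_nbr: "x = u\<^sub>1" if "(x, u\<^sub>0) \<in> edges G\<^sub>0" for x
  proof -
    have "(x, u\<^sub>0) \<in> edges G" "x \<notin> B\<^sub>0" using that by (auto simp: assms(6) delete_def induced_def)
    then show ?thesis using assms(1,5) by (auto simp: neighbours_def simple_graph_def dest: symD)
  qed
  have low: "x = u\<^sub>0 \<and> ?lv x = 0 \<or> x = u\<^sub>1 \<and> ?lv x = 1" if "x \<in> verts G\<^sub>0" "?lv x \<le> 1" for x
    using relpow_distance[OF conn simple that(1)] that(2) root_nbr by (cases "?lv x") auto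
  interpret rooted_graph G\<^sub>0 u\<^sub>0
  proof
    show "claw_free G\<^sub>0" unfolding S by (rule claw_free_induced[OF assms(2)])
    show "odd (length xs)" if "induced_cycle G\<^sub>0 xs" "4 \<le> length xs" for xs
      using odd_induced_cycle[OF assms(3) induced_cycle_induced] that unfolding S by blast
    show "x = y" if "x \<in> verts G\<^sub>0" "y \<in> verts G\<^sub>0" "?lv x = ?lv y" "?lv x \<le> 1" for x y
      using low[of x] low[of y] that by auto
  qed (use simple distance_step[OF conn simple] distance_parent[OF conn simple] in blast)+
  have shape: "\<exists>a j P Q. sym_hole a j P Q \<and> verts H = P ` {a..j} \<union> Q ` {a..j}" if H: "hole G\<^sub>0 H"
    for H
  proof -
    obtain vs where vs: "induced_cycle G\<^sub>0 vs" "set vs = verts H" "4 \<le> length vs"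
      using hole_obtain_cycle[OF H] by blast
    show ?thesis using induced_cycle_sym_hole[OF vs(1,3)] vs(2) by metis
  qed
  obtain a\<^sub>1 j\<^sub>1 P\<^sub>1 Q\<^sub>1 where 1: "sym_hole a\<^sub>1 j\<^sub>1 P\<^sub>1 Q\<^sub>1" "verts H\<^sub>1 = P\<^sub>1 ` {a\<^sub>1..j\<^sub>1} \<union>
    Q\<^sub>1 ` {a\<^sub>1..j\<^sub>1}"
    using shape[OF assms(7)] by blast
  obtain a\<^sub>2 j\<^sub>2 P\<^sub>2 Q\<^sub>2 where 2: "sym_hole a\<^sub>2 j\<^sub>2 P\<^sub>2 Q\<^sub>2" "verts H\<^sub>2 = P\<^sub>2 ` {a\<^sub>2..j\<^sub>2} \<union>
    Q\<^sub>2 ` {a\<^sub>2..j\<^sub>2}"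
    using shape[OF assms(8)] by blast
  \<comment> \<open>Equal sets \<open>tau\<close> therefore intersect, so the second claim is also
    covered by \<open>tau_dichotomy\<close>.\<close>
  have "tau G\<^sub>0 u\<^sub>0 H\<^sub>1 \<noteq> {}" unfolding tau_H[OF 1] using sym_hole_bounds[OF 1(1)] by auto
  then show ?thesis using tau_dichotomy[OF 1 2] by auto
qed

end
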